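(* Let $X$ be a Banach space and let $Q=(Q_n)_{n=0}^\infty$ be an admissible generalized approximation scheme on $X$. Let $Q_\infty=\overline{\bigcup_{n=0}^\infty Q_n}$ (norm closure) and $\mathcal{N}_Q=\{Q_n\}_{n=0}^\infty\cup\{Q_\infty\}\cup\{X\}$. Then for every finite-rank operator $S\in\mathcal{F}(X^{**})$ such that $S(U^{\perp\perp})\subset U^{\perp\perp}$ for all $U\in\mathcal{N}_Q$, all compact subsets $K\subset X^{**}$ and $L\subset X^*$, and every $\epsilon>0$, there exists an operator $T\in\mathcal{F}(X)$ satisfying $T(U)\subset U$ for all $U\in\mathcal{N}_Q$ such that: (1) $\bigl|\|T\|-\|S\|\bigr|<\epsilon$; (2) $|x^{**}(T^*y^* )-(Sx^{**})(y^* )|<\epsilon$ for all $x^{**}\in K$ and $y^*\in L$.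
   Context: For a Banach space $Z$, $\mathcal{F}(Z)$ denotes the bounded linear finite-rank operators on $Z$. For a subspace $U\subset X$, $U^\perp\subset X^*$ is its annihilator and $U^{\perp\perp}=(U^\perp)^\perp\subset X^{**}$ is the annihilator of $U^\perp$ in the bidual. $T^*$ is the adjoint of $T$. A generalized approximation scheme on $X$ is a sequence $Q=(Q_n)_{n=0}^\infty$ of closed linear subspaces of $X$ such that: (GA1) $\{0\}=Q_0\subset Q_1\subset\dots\subset Q_n\subset\dots\subset X$ (inclusions not necessarily strict); (GA2) $\lambda Q_n\subset Q_n$ for all $n$ and all scalars $\lambda$; (GA3) $Q_n+Q_m\subseteq Q_{n+m}$ for all $n,m$. The scheme $Q$ is admissible if $\overline{\bigcup_{n=0}^\infty Q_n^{\perp\perp}}^{\,w^*}=Q_\infty^{\perp\perp}$ in $X^{**}$, where the closure is in the weak-star topology of $X^{**}$ and $Q_\infty=\overline{\bigcup_{n=0}^\infty Q_n}$ is the norm closure in $X$. *)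

theory Defs
  imports "HOL-Analysis.Analysis"
begin

section \<open>Complex normed spaces\<close>

text \<open>
  The scalar field of a Banach space may be the reals or the complex numbers.  The real case is
  the class \<open>banach\<close> with bounded operators \<open>'a \<Rightarrow>\<^sub>L 'b\<close>.  The complex case is set up here in the
  same style: a complex normed space is a real one with a compatible multiplication by complex
  scalars, and the bounded complex-linear operators form a type \<open>'a \<Rightarrow>\<^sub>C\<^sub>L 'b\<close> carrying the
  operator norm.
\<close>

class scaleC =
  fixes scaleC :: "complex \<Rightarrow> 'a \<Rightarrow> 'a"  (infixr \<open>*\<^sub>C\<close> 75)

class complex_normed_vector = real_normed_vector + scaleC +
  assumes scaleC_add_right: "a *\<^sub>C (x + y) = a *\<^sub>C x + a *\<^sub>C y"
    and scaleC_add_left: "(a + b) *\<^sub>C x = a *\<^sub>C x + b *\<^sub>C x"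
    and scaleC_scaleC: "a *\<^sub>C (b *\<^sub>C x) = (a * b) *\<^sub>C x"
    and scaleR_scaleC: "r *\<^sub>R x = complex_of_real r *\<^sub>C x"
    and norm_scaleC: "norm (a *\<^sub>C x) = norm a * norm x"

class complex_banach = complex_normed_vector + banach

lemma vector_space_scaleC:
  "vector_space (scaleC :: complex \<Rightarrow> 'a \<Rightarrow> 'a::complex_normed_vector)"
  by unfold_locales
    (simp_all add: scaleC_add_right scaleC_add_left scaleC_scaleC scaleR_scaleC[of 1, simplified, symmetric])

instantiation complex :: complex_banach
begin
definition scaleC_complex :: "complex \<Rightarrow> complex \<Rightarrow> complex"
  where "scaleC_complex a x = a * x"
instance
  by standard (simp_all add: scaleC_complex_def algebra_simps norm_mult scaleR_conv_of_real)
end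

lemma bounded_linear_scaleC: "bounded_linear (\<lambda>x. a *\<^sub>C (x::'a::complex_normed_vector))"
  by (rule bounded_linear_intro[where K = "norm a"])
    (simp_all add: scaleC_add_right scaleR_scaleC scaleC_scaleC norm_scaleC mult.commute)

lemma blinfun_scaleC:
  fixes f :: "'a::complex_normed_vector \<Rightarrow>\<^sub>L 'b::complex_normed_vector"
  shows "blinfun_apply (Blinfun (\<lambda>x. c *\<^sub>C blinfun_apply f x)) x = c *\<^sub>C blinfun_apply f x"
  by (simp add: bounded_linear_Blinfun_apply
      bounded_linear_compose[OF bounded_linear_scaleC blinfun.bounded_linear_right])

lemma scaleC_minus_right: "a *\<^sub>C (- x) = - (a *\<^sub>C (x::'a::complex_normed_vector))"
  using linear_neg[OF bounded_linear.linear[OF bounded_linear_scaleC], of a x] by simp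

typedef (overloaded) ('a, 'b) cblinfun (\<open>(_ \<Rightarrow>\<^sub>C\<^sub>L /_)\<close> [22, 21] 21) =
  "{f :: 'a::complex_normed_vector \<Rightarrow>\<^sub>L 'b::complex_normed_vector.
      \<forall>c x. blinfun_apply f (c *\<^sub>C x) = c *\<^sub>C blinfun_apply f x}"
  morphisms blinfun_of_cblinfun CBlinfun
  by (rule exI[of _ 0]) (simp add: norm_scaleC flip: norm_eq_zero)

setup_lifting type_definition_cblinfun

lift_definition cblinfun_apply ::
  "('a::complex_normed_vector \<Rightarrow>\<^sub>C\<^sub>L 'b::complex_normed_vector) \<Rightarrow> 'a \<Rightarrow> 'b"
  is blinfun_apply .

instantiation cblinfun :: (complex_normed_vector, complex_normed_vector) complex_normed_vector
begin

lift_definition norm_cblinfun :: "('a \<Rightarrow>\<^sub>C\<^sub>L 'b) \<Rightarrow> real" is norm .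

lift_definition zero_cblinfun :: "'a \<Rightarrow>\<^sub>C\<^sub>L 'b" is 0
  by (simp add: norm_scaleC flip: norm_eq_zero)

lift_definition plus_cblinfun :: "('a \<Rightarrow>\<^sub>C\<^sub>L 'b) \<Rightarrow> ('a \<Rightarrow>\<^sub>C\<^sub>L 'b) \<Rightarrow> ('a \<Rightarrow>\<^sub>C\<^sub>L 'b)" is "(+)"
  by (simp add: blinfun.add_left scaleC_add_right)

lift_definition scaleC_cblinfun :: "complex \<Rightarrow> ('a \<Rightarrow>\<^sub>C\<^sub>L 'b) \<Rightarrow> ('a \<Rightarrow>\<^sub>C\<^sub>L 'b)"
  is "\<lambda>c f. Blinfun (\<lambda>x. c *\<^sub>C blinfun_apply f x)"
  by (simp add: blinfun_scaleC scaleC_scaleC mult.commute)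

lift_definition scaleR_cblinfun :: "real \<Rightarrow> ('a \<Rightarrow>\<^sub>C\<^sub>L 'b) \<Rightarrow> ('a \<Rightarrow>\<^sub>C\<^sub>L 'b)" is "scaleR"
  by (simp add: blinfun.scaleR_left scaleR_scaleC scaleC_scaleC mult.commute)

lift_definition uminus_cblinfun :: "('a \<Rightarrow>\<^sub>C\<^sub>L 'b) \<Rightarrow> ('a \<Rightarrow>\<^sub>C\<^sub>L 'b)" is uminus
  by (simp add: blinfun.minus_left scaleC_minus_right)

definition minus_cblinfun :: "('a \<Rightarrow>\<^sub>C\<^sub>L 'b) \<Rightarrow> ('a \<Rightarrow>\<^sub>C\<^sub>L 'b) \<Rightarrow> ('a \<Rightarrow>\<^sub>C\<^sub>L 'b)"
  where "minus_cblinfun f g = f + (- g)"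

definition dist_cblinfun :: "('a \<Rightarrow>\<^sub>C\<^sub>L 'b) \<Rightarrow> ('a \<Rightarrow>\<^sub>C\<^sub>L 'b) \<Rightarrow> real"
  where "dist_cblinfun f g = norm (f - g)"

definition sgn_cblinfun :: "('a \<Rightarrow>\<^sub>C\<^sub>L 'b) \<Rightarrow> ('a \<Rightarrow>\<^sub>C\<^sub>L 'b)"
  where "sgn_cblinfun f = inverse (norm f) *\<^sub>R f"

definition uniformity_cblinfun :: "(('a \<Rightarrow>\<^sub>C\<^sub>L 'b) \<times> ('a \<Rightarrow>\<^sub>C\<^sub>L 'b)) filter"
  where "uniformity_cblinfun = (INF e\<in>{0<..}. principal {(f, g). dist f g < e})"

definition open_cblinfun :: "('a \<Rightarrow>\<^sub>C\<^sub>L 'b) set \<Rightarrow> bool"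
  where "open_cblinfun S \<longleftrightarrow> (\<forall>f\<in>S. \<forall>\<^sub>F (f', g) in uniformity. f' = f \<longrightarrow> g \<in> S)"

instance
proof
  fix f g h :: "'a \<Rightarrow>\<^sub>C\<^sub>L 'b" and a b :: complex and r s :: real
  show "f + g + h = f + (g + h)" by transfer (simp add: add.assoc)
  show "f + g = g + f" by transfer (simp add: add.commute)
  show "0 + f = f" by transfer simp
  show "- f + f = 0" by transfer simp
  show "f - g = f + - g" by (rule minus_cblinfun_def)
  show "r *\<^sub>R (f + g) = r *\<^sub>R f + r *\<^sub>R g" by transfer (simp add: scaleR_add_right)
  show "(r + s) *\<^sub>R f = r *\<^sub>R f + s *\<^sub>R f" by transfer (simp add: scaleR_add_left)
  show "r *\<^sub>R s *\<^sub>R f = (r * s) *\<^sub>R f" by transfer simp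
  show "1 *\<^sub>R f = f" by transfer simp
  show "dist f g = norm (f - g)" by (rule dist_cblinfun_def)
  show "sgn f = inverse (norm f) *\<^sub>R f" by (rule sgn_cblinfun_def)
  show "(uniformity :: (('a \<Rightarrow>\<^sub>C\<^sub>L 'b) \<times> ('a \<Rightarrow>\<^sub>C\<^sub>L 'b)) filter) =
      (INF e\<in>{0<..}. principal {(x, y). dist x y < e})"
    by (rule uniformity_cblinfun_def)
  show "open U = (\<forall>x\<in>U. \<forall>\<^sub>F (x', y) in uniformity. x' = x \<longrightarrow> y \<in> U)"
    for U :: "('a \<Rightarrow>\<^sub>C\<^sub>L 'b) set"
    by (rule open_cblinfun_def)
  show "norm f = 0 \<longleftrightarrow> f = 0" by transfer simp
  show "norm (f + g) \<le> norm f + norm g" by transfer (rule norm_triangle_ineq)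
  show "norm (r *\<^sub>R f) = \<bar>r\<bar> * norm f" by transfer simp
  show "a *\<^sub>C (f + g) = a *\<^sub>C f + a *\<^sub>C g"
    by transfer
      (rule blinfun_eqI, simp only: blinfun_scaleC, simp only: blinfun_scaleC blinfun.add_left, simp add: scaleC_add_right)
  show "(a + b) *\<^sub>C f = a *\<^sub>C f + b *\<^sub>C f"
    by transfer
      (rule blinfun_eqI, simp only: blinfun_scaleC, simp only: blinfun_scaleC blinfun.add_left, simp add: scaleC_add_left)
  show "a *\<^sub>C (b *\<^sub>C f) = (a * b) *\<^sub>C f"
    by transfer (rule blinfun_eqI, simp only: blinfun_scaleC scaleC_scaleC)
  show "r *\<^sub>R f = complex_of_real r *\<^sub>C f"
    by transfer
      (rule blinfun_eqI, simp only: blinfun_scaleC, simp only: blinfun_scaleC blinfun.scaleR_left, simp add: scaleR_scaleC)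
  show "norm (a *\<^sub>C f) = norm a * norm f"
  proof transfer
    fix a and F :: "'a \<Rightarrow>\<^sub>L 'b"
    let ?G = "Blinfun (\<lambda>x. a *\<^sub>C blinfun_apply F x)"
    show "norm ?G = norm a * norm F"
    proof (cases "a = 0")
      case True
      have "norm (?G x) = 0" for x by (simp add: blinfun_scaleC True norm_scaleC)
      then have "?G = 0" by (intro blinfun_eqI) simp
      then show ?thesis using True by simp
    next
      case False
      show ?thesis
      proof (rule antisym)
        show "norm ?G \<le> norm a * norm F"
          by (rule norm_blinfun_bound)
            (simp_all add: blinfun_scaleC norm_scaleC mult.assoc mult_left_mono norm_blinfun)
        have "norm F \<le> norm ?G / norm a"
        proof (rule norm_blinfun_bound)
          fix x
          have "norm a * norm (F x) = norm (?G x)" by (simp add: blinfun_scaleC norm_scaleC)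
          also have "\<dots> \<le> norm ?G * norm x" by (rule norm_blinfun)
          finally show "norm (F x) \<le> norm ?G / norm a * norm x"
            using False by (simp add: field_simps)
        qed simp
        then show "norm a * norm F \<le> norm ?G"
          using False by (simp add: field_simps)
      qed
    qed
  qed
qed

end

lift_definition cblinfun_compose ::
  "('b::complex_normed_vector \<Rightarrow>\<^sub>C\<^sub>L 'c::complex_normed_vector) \<Rightarrow>
    ('a::complex_normed_vector \<Rightarrow>\<^sub>C\<^sub>L 'b) \<Rightarrow> ('a \<Rightarrow>\<^sub>C\<^sub>L 'c)"  (infixl \<open>o\<^sub>C\<^sub>L\<close> 55)
  is blinfun_compose
  by simp

section \<open>Duals, adjoints, finite-rank operators\<close>

type_synonym 'a dual = "'a \<Rightarrow>\<^sub>L real"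
type_synonym 'a bidual = "'a dual dual"
type_synonym 'a cdual = "'a \<Rightarrow>\<^sub>C\<^sub>L complex"
type_synonym 'a cbidual = "'a cdual cdual"

definition adjoint_op :: "('a::real_normed_vector \<Rightarrow>\<^sub>L 'b::real_normed_vector) \<Rightarrow> 'b dual \<Rightarrow> 'a dual"
  where "adjoint_op T y = y o\<^sub>L T"

definition cadjoint_op ::
  "('a::complex_normed_vector \<Rightarrow>\<^sub>C\<^sub>L 'b::complex_normed_vector) \<Rightarrow> 'b cdual \<Rightarrow> 'a cdual"
  where "cadjoint_op T y = y o\<^sub>C\<^sub>L T"

text \<open>
  From here on the definitions serve both scalar fields.  They take the scalar multiplication
  \<open>smul\<close> (\<open>scaleR\<close> or \<open>scaleC\<close>) and the evaluation \<open>ev\<close> of functionals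
  (\<open>blinfun_apply\<close> or \<open>cblinfun_apply\<close>) as parameters.
\<close>

definition finite_rank :: "('k::field \<Rightarrow> 'a::ab_group_add \<Rightarrow> 'a) \<Rightarrow> ('b \<Rightarrow> 'a) \<Rightarrow> bool"
  where "finite_rank smul T \<longleftrightarrow> (\<exists>B. finite B \<and> range T \<subseteq> module.span smul B)"

definition annihilator :: "('d \<Rightarrow> 'a \<Rightarrow> 'k::zero) \<Rightarrow> 'a set \<Rightarrow> 'd set"
  where "annihilator ev U = {f. \<forall>x\<in>U. ev f x = 0}"

abbreviation biannihilator :: "'a::real_normed_vector set \<Rightarrow> 'a bidual set"
  where "biannihilator U \<equiv> annihilator blinfun_apply (annihilator blinfun_apply U)"

abbreviation cbiannihilator :: "'a::complex_normed_vector set \<Rightarrow> 'a cbidual set"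
  where "cbiannihilator U \<equiv> annihilator cblinfun_apply (annihilator cblinfun_apply U)"

text \<open>
  The topology \<open>euclidean\<close> on functions \<open>'a \<Rightarrow> 'k\<close> is the product topology, so its pullback is
  the topology of pointwise convergence.  For \<open>ev = blinfun_apply\<close> it is
  \<open>strong_operator_topology\<close>.
\<close>

definition weak_star_topology :: "('d \<Rightarrow> 'a \<Rightarrow> 'k::topological_space) \<Rightarrow> 'd topology"
  where "weak_star_topology ev = pullback_topology UNIV ev euclidean"

section \<open>Generalized approximation schemes\<close>

definition ga_scheme :: "('k::field \<Rightarrow> 'a::real_normed_vector \<Rightarrow> 'a) \<Rightarrow> (nat \<Rightarrow> 'a set) \<Rightarrow> bool"
  where "ga_scheme smul Q \<longleftrightarrow>
    (\<forall>n. module.subspace smul (Q n) \<and> closed (Q n)) \<and>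
    Q 0 = {0} \<and> (\<forall>n. Q n \<subseteq> Q (Suc n)) \<and>
    (\<forall>n c. smul c ` Q n \<subseteq> Q n) \<and>
    (\<forall>n m. \<forall>x\<in>Q n. \<forall>y\<in>Q m. x + y \<in> Q (n + m))"

definition scheme_limit :: "(nat \<Rightarrow> 'a::topological_space set) \<Rightarrow> 'a set"
  where "scheme_limit Q = closure (\<Union>n. Q n)"

definition scheme_nest :: "(nat \<Rightarrow> 'a::topological_space set) \<Rightarrow> 'a set set"
  where "scheme_nest Q = range Q \<union> {scheme_limit Q} \<union> {UNIV}"

definition admissible :: "(nat \<Rightarrow> 'a::real_normed_vector set) \<Rightarrow> bool"
  where "admissible Q \<longleftrightarrow>
    weak_star_topology blinfun_apply closure_of (\<Union>n. biannihilator (Q n)) =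
      biannihilator (scheme_limit Q)"

definition cadmissible :: "(nat \<Rightarrow> 'a::complex_normed_vector set) \<Rightarrow> bool"
  where "cadmissible Q \<longleftrightarrow>
    weak_star_topology cblinfun_apply closure_of (\<Union>n. cbiannihilator (Q n)) =
      cbiannihilator (scheme_limit Q)"

end

theory Submission
  imports Defs
begin

text \<open>
  The operator \<open>S\<close> splits into rank-one terms \<open>s\<^sub>j \<otimes> e\<^sub>j\<close> that leave the same chain of
  biannihilators invariant.  The principle of local reflexivity is applied twice: it moves the \<open>e\<^sub>j\<close>
  from \<open>X\<^sup>*\<^sup>*\<close> to vectors \<open>x\<^sub>j\<close> of \<open>X\<close>, and then the \<open>s\<^sub>j\<close> from \<open>X\<^sup>*\<^sup>*\<^sup>*\<close> to functionals \<open>f\<^sub>j\<close> in \<open>X\<^sup>*\<close>,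
  with \<open>T = \<Sum>\<^sub>j f\<^sub>j \<otimes> x\<^sub>j\<close>.  The only delicate \<open>e\<^sub>j\<close> are those in \<open>Q\<^sub>\<infinity>\<^sup>\<bottom>\<^sup>\<bottom>\<close> but in no \<open>Q\<^sub>n\<^sup>\<bottom>\<^sup>\<bottom>\<close>:
  there \<open>x\<^sub>j\<close> is taken in the non-closed union of the \<open>Q\<^sub>n\<close>, which has the same biannihilator as
  \<open>Q\<^sub>\<infinity>\<close>, so \<open>x\<^sub>j\<close> lies in some \<open>Q\<^sub>m\<close> and \<open>f\<^sub>j\<close> only has to vanish on the preceding member of the
  nest.  The complex case is reduced to the real one by averaging.
\<close>

section \<open>The Hahn-Banach theorem\<close>

text \<open>If \<open>x j\<close> were chosen in the closed space \<open>scheme_limit Q\<close> but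
  outside every \<open>Q n\<close>, then \<open>f j\<close> would have to vanish on all
  \<open>Q n\<close> and hence on their closure, so \<open>s j\<close> would have to vanish on the
  biannihilator of the limit. It is only known to vanish on the biannihilators of the
  \<open>Q n\<close>. Their union may fail to be norm dense in the larger biannihilator, and
  \<open>s j\<close> is merely norm continuous. In the unclosed union, \<open>x j\<close> is reached
  at a finite index. The vectors come before the functionals, since the space on which
  \<open>f j\<close> must vanish depends on where \<open>x j\<close> landed. Replacing
  \<open>e j\<close> by \<open>x j\<close> gives a map from the bidual to the space with almost the
  norm of \<open>S\<close>. Its adjoint, the sum of the \<open>y (x j) *\<^sub>R s j\<close>, again
  has the shape required by local reflexivity, now over the dual space. Replacing \<open>s j\<close>
  by \<open>f j\<close> there produces the adjoint of \<open>T\<close>, whose norm bounds that of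
  \<open>T\<close>. Each replacement costs \<epsilon>/2.\<close>

definition sublinear :: "('a::real_vector \<Rightarrow> real) \<Rightarrow> bool"
  where "sublinear q \<longleftrightarrow> (\<forall>x y. q (x + y) \<le> q x + q y) \<and> (\<forall>t\<ge>0. \<forall>x. q (t *\<^sub>R x) = t * q x)"

text \<open>One inequality for positive scalars suffices: applied to the scalar 1/t it yields the
  reverse one.\<close>

lemma sublinearI:
  assumes "\<And>x y. q (x + y) \<le> q x + q y" and "q 0 = 0"
    and "\<And>t x. t > 0 \<Longrightarrow> q (t *\<^sub>R x) \<le> t * q x"
  shows "sublinear q"
  unfolding sublinear_def
proof (intro conjI allI impI)
  fix t :: real and x assume "t \<ge> 0"
  show "q (t *\<^sub>R x) = t * q x"
  proof (cases "t = 0")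
    case False
    then have t: "t > 0" using \<open>t \<ge> 0\<close> by simp
    have "q ((1 / t) *\<^sub>R t *\<^sub>R x) \<le> (1 / t) * q (t *\<^sub>R x)" by (rule assms(3)) (simp add: t)
    then have "t * q x \<le> q (t *\<^sub>R x)" using t by (simp add: field_simps)
    with assms(3)[OF t, of x] show ?thesis by simp
  qed (simp add: assms(2))
qed (rule assms(1))

lemma sublinear_add: "sublinear q \<Longrightarrow> q (x + y) \<le> q x + q y"
  by (simp add: sublinear_def)

lemma sublinear_scaleR: "sublinear q \<Longrightarrow> t \<ge> 0 \<Longrightarrow> q (t *\<^sub>R x) = t * q x"
  by (simp add: sublinear_def)

lemma sublinear_zero: "sublinear q \<Longrightarrow> q 0 = 0"
  using sublinear_scaleR[of q 0 0] by simp

lemma sublinear_minus_le: "sublinear q \<Longrightarrow> - q (- x) \<le> q x"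
  using sublinear_add[of q x "- x"] by (simp add: sublinear_zero)

lemma sublinear_norm: "sublinear (norm :: 'a::real_normed_vector \<Rightarrow> real)"
  by (simp add: sublinear_def norm_triangle_ineq)

text \<open>A pair (t, w) in \<open>C\<close> stands for the demand g w \<ge> t on a linear g. Any
  linear g below \<open>p\<close> meets all these demands, because g (- w) \<le> - t. The infimum of
  q (x + w) - t is finite since q (x + w) + q (- x) \<ge> q w \<ge> t. Minimality in the Hahn-Banach
  theorem and separation from a ball both arise from suitable cones.\<close>

lemma sublinear_cone_inf:
  fixes q :: "'a::real_vector \<Rightarrow> real"
  assumes q: "sublinear q"
    and C0: "(0, 0) \<in> C"
    and Cadd: "\<And>s t v w. (s, v) \<in> C \<Longrightarrow> (t, w) \<in> C \<Longrightarrow> (s + t, v + w) \<in> C"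
    and Cscale: "\<And>r t w. r > 0 \<Longrightarrow> (t, w) \<in> C \<Longrightarrow> (r * t, r *\<^sub>R w) \<in> C"
    and Cle: "\<And>t w. (t, w) \<in> C \<Longrightarrow> t \<le> q w"
  obtains p where "sublinear p" and "\<And>x. p x \<le> q x" and "\<And>t w. (t, w) \<in> C \<Longrightarrow> p (- w) \<le> - t"
proof -
  define p where "p x = (INF (t, w)\<in>C. q (x + w) - t)" for x
  have lower: "- q (- x) \<le> q (x + w) - t" if "(t, w) \<in> C" for t w x
    using sublinear_add[OF q, of "x + w" "- x"] Cle[OF that] by (simp add: algebra_simps)
  have ne: "C \<noteq> {}" using C0 by auto
  have bdd: "bdd_below ((\<lambda>(t, w). q (x + w) - t) ` C)" for x
    by (rule bdd_belowI[of _ "- q (- x)"]) (auto intro: lower)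
  have p_le: "p x \<le> q (x + w) - t" if "(t, w) \<in> C" for t w x
    unfolding p_def using cINF_lower[OF bdd that] by simp
  have le_p: "r \<le> p x" if "\<And>t w. (t, w) \<in> C \<Longrightarrow> r \<le> q (x + w) - t" for r x
    unfolding p_def using that by (intro cINF_greatest[OF ne]) auto
  have "sublinear p"
  proof (rule sublinearI)
    fix x y
    have "p (x + y) - (q (y + w) - t) \<le> p x" if tw: "(t, w) \<in> C" for t w
    proof (rule le_p)
      fix s v assume "(s, v) \<in> C"
      from p_le[OF Cadd[OF this tw], of "x + y"]
      show "p (x + y) - (q (y + w) - t) \<le> q (x + v) - s"
        using sublinear_add[OF q, of "x + v" "y + w"] by (simp add: algebra_simps)
    qed
    then have "p (x + y) - p x \<le> p y"
      by (intro le_p) (simp add: algebra_simps)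
    then show "p (x + y) \<le> p x + p y" by simp
  next
    show "p 0 = 0"
      using p_le[OF C0, of 0] le_p[of 0 0] Cle by (force simp: sublinear_zero[OF q])
  next
    fix r :: real and x assume r: "r > 0"
    have "p (r *\<^sub>R x) / r \<le> p x"
    proof (rule le_p)
      fix t w assume "(t, w) \<in> C"
      from p_le[OF Cscale[OF r this], of "r *\<^sub>R x"]
      have "p (r *\<^sub>R x) \<le> q (r *\<^sub>R (x + w)) - r * t" by (simp add: algebra_simps)
      then have "p (r *\<^sub>R x) \<le> r * (q (x + w) - t)"
        using sublinear_scaleR[OF q, of r "x + w"] r by (simp add: right_diff_distrib)
      then show "p (r *\<^sub>R x) / r \<le> q (x + w) - t" using r by (simp add: field_simps)
    qed
    then show "p (r *\<^sub>R x) \<le> r * p x" using r by (simp add: field_simps)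
  qed
  moreover have "p x \<le> q x" for x using p_le[OF C0] by simp
  moreover have "p (- w) \<le> - t" if "(t, w) \<in> C" for t w
    using p_le[OF that, of "- w"] by (simp add: sublinear_zero[OF q])
  ultimately show thesis by (rule that)
qed

text \<open>Comparability is what gives subadditivity: for two members, the smaller one evaluated at
  x + y lies below f x + g y. The common bound \<open>q\<close> keeps the infimum finite.\<close>

lemma sublinear_chain_inf:
  assumes ne: "F \<noteq> {}" and sub: "\<And>f. f \<in> F \<Longrightarrow> sublinear f" and le: "\<And>f x. f \<in> F \<Longrightarrow> f x \<le> q x"
    and chain: "\<And>f g. f \<in> F \<Longrightarrow> g \<in> F \<Longrightarrow> (\<forall>x. f x \<le> g x) \<or> (\<forall>x. g x \<le> f x)"
  shows "sublinear (\<lambda>x. INF f\<in>F. f x)" and "\<And>f x. f \<in> F \<Longrightarrow> (INF f\<in>F. f x) \<le> f x"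
proof -
  have lower: "- q (- x) \<le> f x" if "f \<in> F" for f x
    using sublinear_minus_le[OF sub[OF that], of x] le[OF that, of "- x"] by simp
  have bdd: "bdd_below ((\<lambda>f. f x) ` F)" for x
    by (rule bdd_belowI[of _ "- q (- x)"]) (auto intro: lower)
  show low: "(INF f\<in>F. f x) \<le> f x" if "f \<in> F" for f x
    by (rule cINF_lower[OF bdd that])
  show "sublinear (\<lambda>x. INF f\<in>F. f x)"
  proof (rule sublinearI)
    fix x y
    have "(INF f\<in>F. f (x + y)) \<le> f x + g y" if f: "f \<in> F" and g: "g \<in> F" for f g
      using chain[OF f g]
    proof
      assume fg: "\<forall>x. f x \<le> g x"
      show ?thesis using low[OF f, of "x + y"] sublinear_add[OF sub[OF f], of x y] fg[rule_format, of y] by simp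
    next
      assume gf: "\<forall>x. g x \<le> f x"
      show ?thesis using low[OF g, of "x + y"] sublinear_add[OF sub[OF g], of x y] gf[rule_format, of x] by simp
    qed
    then have "(INF f\<in>F. f (x + y)) - g y \<le> (INF f\<in>F. f x)" if "g \<in> F" for g
      using that by (intro cINF_greatest[OF ne]) (simp add: algebra_simps)
    then have "(INF f\<in>F. f (x + y)) - (INF f\<in>F. f x) \<le> (INF f\<in>F. f y)"
      by (intro cINF_greatest[OF ne]) (simp add: algebra_simps)
    then show "(INF f\<in>F. f (x + y)) \<le> (INF f\<in>F. f x) + (INF f\<in>F. f y)" by simp
  next
    have "(\<lambda>f. f 0) ` F = {0}" using ne sublinear_zero[OF sub] by (auto simp: image_iff)
    then show "(INF f\<in>F. f 0) = 0" by simp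
  next
    fix t :: real and x assume t: "t > 0"
    have "(INF f\<in>F. f (t *\<^sub>R x)) / t \<le> (INF f\<in>F. f x)"
    proof (rule cINF_greatest[OF ne])
      fix f assume f: "f \<in> F"
      show "(INF f\<in>F. f (t *\<^sub>R x)) / t \<le> f x"
        using low[OF f, of "t *\<^sub>R x"] t sublinear_scaleR[OF sub[OF f], of t x] by (simp add: field_simps)
    qed
    then show "(INF f\<in>F. f (t *\<^sub>R x)) \<le> t * (INF f\<in>F. f x)" using t by (simp add: field_simps)
  qed
qed

text \<open>A minimal sublinear function below \<open>q\<close> is already linear, so no extension
  from subspaces is required.\<close>

theorem Hahn_Banach_sublinear:
  fixes q :: "'a::real_vector \<Rightarrow> real"
  assumes q: "sublinear q"
  obtains g where "linear g" and "\<And>x. g x \<le> q x"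
proof -
  define A where "A = {f. sublinear f \<and> (\<forall>x. f x \<le> q x)}"
  \<comment> \<open>The order is reversed, so that the maximal element delivered by Zorn's lemma is
    pointwise minimal.\<close>
  define P where "P f g \<longleftrightarrow> (\<forall>x. g x \<le> f x)" for f g :: "'a \<Rightarrow> real"
  have "\<exists>m\<in>A. \<forall>a\<in>A. P m a \<longrightarrow> a = m"
  proof (rule predicate_Zorn)
    show "partial_order_on A (relation_of P A)"
    proof (rule partial_order_on_relation_ofI)
      show "P a c" if "P a b" "P b c" for a b c using order_trans[OF that(2)[unfolded P_def, rule_format] that(1)[unfolded P_def, rule_format]] by (simp add: P_def)
      show "a = b" if "P a b" "P b a" for a b
        using that unfolding P_def by (intro ext antisym) auto
    qed (simp add: P_def)
    fix C assume C: "C \<in> Chains (relation_of P A)"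
    show "\<exists>u\<in>A. \<forall>a\<in>C. P a u"
    proof (cases "C = {}")
      case True
      then show ?thesis using q by (auto simp: A_def)
    next
      case False
      have CA: "C \<subseteq> A" using C by (auto simp: Chains_def relation_of_def)
      have chain: "(\<forall>x. f x \<le> g x) \<or> (\<forall>x. g x \<le> f x)" if "f \<in> C" "g \<in> C" for f g
        using C that by (auto simp: Chains_def relation_of_def P_def)
      note inf = sublinear_chain_inf[OF False _ _ chain, where q = q]
      have "sublinear (\<lambda>x. INF f\<in>C. f x)" by (rule inf(1)) (use CA A_def in auto)
      moreover have low: "(INF f\<in>C. f x) \<le> f x" if "f \<in> C" for f x
        by (rule inf(2)) (use CA A_def that in auto)
      moreover obtain f where f: "f \<in> C" using False by auto
      moreover have "(INF f\<in>C. f x) \<le> q x" for x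
        using order_trans[OF low[OF f]] f CA by (auto simp: A_def)
      ultimately have "(\<lambda>x. INF f\<in>C. f x) \<in> A"
        by (simp add: A_def)
      then show ?thesis using low unfolding P_def by (intro bexI ballI allI)
    qed
  qed
  then obtain m where m: "sublinear m" "\<And>x. m x \<le> q x"
    and min: "\<And>f. sublinear f \<Longrightarrow> (\<And>x. f x \<le> m x) \<Longrightarrow> f = m"
    unfolding A_def P_def by (auto, meson order_trans)
  \<comment> \<open>Oddness is all that separates sublinear from linear. The ray through (m y, y) is
    a cone that forces p (- y) \<le> - m y for some sublinear p below m, and minimality gives p =
    m.\<close>
  have neg: "m (- y) = - m y" for y
  proof (rule antisym)
    define C where "C = {(t, w). \<exists>s\<ge>0. t = s * m y \<and> w = s *\<^sub>R y}"
    obtain p where p: "sublinear p" "\<And>x. p x \<le> m x"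
      and cone: "\<And>t w. (t, w) \<in> C \<Longrightarrow> p (- w) \<le> - t"
    proof (rule sublinear_cone_inf[OF m(1), where C = C])
      show "(0, 0) \<in> C" by (auto simp: C_def)
      fix t w assume "(t, w) \<in> C"
      then obtain b where b: "b \<ge> 0" "t = b * m y" "w = b *\<^sub>R y" by (auto simp: C_def)
      then show "t \<le> m w" by (simp add: sublinear_scaleR[OF m(1)])
      show "(r * t, r *\<^sub>R w) \<in> C" if "r > 0" for r
        unfolding C_def using b that by (intro CollectI case_prodI exI[of _ "r * b"]) simp
      fix s v assume "(s, v) \<in> C"
      then obtain a where "a \<ge> 0" "s = a * m y" "v = a *\<^sub>R y" by (auto simp: C_def)
      then show "(s + t, v + w) \<in> C"
        unfolding C_def using b by (intro CollectI case_prodI exI[of _ "a + b"]) (simp add: algebra_simps)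
    qed blast
    have "p (- y) \<le> - m y" by (rule cone) (auto simp: C_def intro: exI[of _ 1])
    then show "m (- y) \<le> - m y" using min[OF p] by simp
  qed (use sublinear_minus_le[OF m(1), of y] in simp)
  have add: "m (x + y) = m x + m y" for x y
    using sublinear_add[OF m(1), of x y] sublinear_add[OF m(1), of "x + y" "- y"] by (simp add: neg)
  have "m (t *\<^sub>R x) = t * m x" for t x
  proof (cases "t \<ge> 0")
    case False
    then have "m (- (t *\<^sub>R x)) = - t * m x" using sublinear_scaleR[OF m(1), of "- t" x] by simp
    then show ?thesis using neg[of "t *\<^sub>R x"] by simp
  qed (simp add: sublinear_scaleR[OF m(1)])
  then have "linear m" by (intro linearI) (auto simp: add)
  then show thesis using m(2) by (rule that)
qed

text \<open>The cone over \<open>D\<close> with height \<open>t * c\<close> at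
  \<open>t *\<^sub>R w\<close> demands the value \<open>c\<close> on all of \<open>D\<close>;
  starting from the norm as sublinear function bounds the functional by 1 at the same time.\<close>

lemma separate_convex_ball:
  fixes D :: "'a::real_normed_vector set"
  assumes D: "convex D" "D \<noteq> {}" and c: "0 \<le> c" "\<And>w. w \<in> D \<Longrightarrow> c \<le> norm w"
  obtains g :: "'a dual" where "norm g \<le> 1" and "\<And>w. w \<in> D \<Longrightarrow> c \<le> g w"
proof -
  define C where "C = {(t * c, t *\<^sub>R w) | t w. t \<ge> 0 \<and> w \<in> D}"
  have CE: thesis if "(t', w') \<in> C"
    and "\<And>t w. t \<ge> 0 \<Longrightarrow> w \<in> D \<Longrightarrow> t' = t * c \<Longrightarrow> w' = t *\<^sub>R w \<Longrightarrow> thesis" for t' w' thesis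
    using that(1) unfolding C_def by (elim CollectE exE conjE Pair_inject) (rule that(2))
  have CI: "(t', w') \<in> C" if "t \<ge> 0" "w \<in> D" "t' = t * c" "w' = t *\<^sub>R w" for t t' w w'
    using that unfolding C_def by blast
  obtain p where p: "sublinear p" "\<And>x. p x \<le> norm x"
    and cone: "\<And>t w. (t, w) \<in> C \<Longrightarrow> p (- w) \<le> - t"
  proof (rule sublinear_cone_inf[OF sublinear_norm, where C = C])
    show "(0, 0) \<in> C" using D(2) by (force simp: C_def)
    show "(s' + t', v' + w') \<in> C" if sv: "(s', v') \<in> C" and tw: "(t', w') \<in> C" for s' t' v' w'
    proof -
      obtain s v where s: "s \<ge> 0" "v \<in> D" "s' = s * c" "v' = s *\<^sub>R v" using CE[OF sv] by blast
      obtain t w where t: "t \<ge> 0" "w \<in> D" "t' = t * c" "w' = t *\<^sub>R w" using CE[OF tw] by blast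
      show ?thesis
      proof (cases "s + t = 0")
        case True
        then have "s = 0" "t = 0" using s t by auto
        then show ?thesis using s t by (force simp: C_def)
      next
        case False
        \<comment> \<open>The convex combination whose multiple by s + t is the sum of the two cone
          vectors.\<close>
        define u where "u = (s / (s + t)) *\<^sub>R v + (t / (s + t)) *\<^sub>R w"
        have "u \<in> D" unfolding u_def
          by (rule convexD[OF D(1)]) (use s t False in \<open>auto simp: add_divide_distrib[symmetric]\<close>)
        moreover have "v' + w' = (s + t) *\<^sub>R u" using False by (simp add: u_def s t scaleR_add_right)
        moreover have "s' + t' = (s + t) * c" by (simp add: s t algebra_simps)
        ultimately show ?thesis using s t by (intro CI[of "s + t" u]) simp_all
      qed
    qed
    show "(r * t, r *\<^sub>R w) \<in> C" if r: "r > 0" and tw: "(t, w) \<in> C" for r t w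
    proof -
      obtain s v where "s \<ge> 0" "v \<in> D" "t = s * c" "w = s *\<^sub>R v" using CE[OF tw] by blast
      then have "r * s \<ge> 0" "r * t = (r * s) * c" "r *\<^sub>R w = (r * s) *\<^sub>R v" using r by auto
      then show ?thesis using \<open>v \<in> D\<close> by (intro CI[of "r * s" v])
    qed
    show "t \<le> norm w" if "(t, w) \<in> C" for t w
      using that c by (auto simp: C_def mult_left_mono)
  qed blast
  obtain g where g: "linear g" "\<And>x. g x \<le> p x" using Hahn_Banach_sublinear[OF p(1)] by blast
  have bound: "norm (g x) \<le> norm x * 1" for x
    using order_trans[OF g(2) p(2), of x] order_trans[OF g(2) p(2), of "- x"]
    by (simp add: linear_neg[OF g(1)] abs_le_iff)
  then have bl: "bounded_linear g"
    by (intro bounded_linear_intro[where K = 1]) (simp_all add: linear_add[OF g(1)] linear_scale[OF g(1)])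
  show thesis
  proof (rule that[of "Blinfun g"])
    show "norm (Blinfun g) \<le> 1"
      by (rule norm_blinfun_bound) (use bound in \<open>auto simp: bounded_linear_Blinfun_apply[OF bl] mult.commute\<close>)
    fix w assume "w \<in> D"
    then have "(c, w) \<in> C" by (force simp: C_def)
    then have "g (- w) \<le> - c" using cone g(2) order_trans by blast
    then show "c \<le> Blinfun g w" by (simp add: bounded_linear_Blinfun_apply[OF bl] linear_neg[OF g(1)])
  qed
qed

lemma norming_functional:
  fixes x :: "'a::real_normed_vector"
  obtains g :: "'a dual" where "norm g \<le> 1" and "g x = norm x"
proof -
  obtain g :: "'a dual" where g: "norm g \<le> 1" "\<And>w. w \<in> {x} \<Longrightarrow> norm x \<le> g w"
    by (rule separate_convex_ball[of "{x}" "norm x"]) auto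
  have "g x \<le> norm x"
    using norm_blinfun[of g x] mult_right_mono[OF g(1) norm_ge_zero[of x]] by simp
  then show thesis using g by (intro that[of g]) (auto intro: antisym)
qed

section \<open>Local reflexivity with prescribed subspaces\<close>

text \<open>Induction on \<open>F\<close>: the value at f is met by a multiple of some u in
  \<open>U\<close> with f u = 1, and the other functionals are handled inside the kernel of f in
  \<open>U\<close>, where the value at f can no longer change. This works because \<open>e\<close>
  minus e f times evaluation at u lies in the biannihilator of that kernel. There is no norm control
  at this stage.\<close>

lemma bidual_interpolation:
  fixes e :: "'a::real_normed_vector bidual" and F :: "'a dual set"
  assumes "finite F" and "subspace U" and "e \<in> biannihilator U"
  shows "\<exists>x\<in>U. \<forall>f\<in>F. blinfun_apply f x = e f"
  using assms
proof (induction F arbitrary: U e rule: finite_induct)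
  case empty
  then show ?case by (auto intro: subspace_0)
next
  case (insert f F)
  show ?case
  proof (cases "\<exists>v\<in>U. f v \<noteq> 0")
    case False
    then have "e f = 0" using insert.prems(2) by (auto simp: annihilator_def)
    moreover obtain x where "x \<in> U" "\<forall>g\<in>F. blinfun_apply g x = e g" using insert.IH[OF insert.prems] by blast
    ultimately show ?thesis using False by (intro bexI[of _ x]) auto
  next
    case True
    then obtain v where v: "v \<in> U" "f v \<noteq> 0" by auto
    define u where "u = (1 / f v) *\<^sub>R v"
    have u: "u \<in> U" "f u = 1" using v insert.prems(1) by (auto simp: u_def blinfun.scaleR_right subspace_scale)
    define ev :: "'a bidual" where "ev = Blinfun (\<lambda>h. blinfun_apply h u)"
    have ev: "ev h = h u" for h
      by (simp add: ev_def bounded_linear_Blinfun_apply blinfun.bounded_linear_left)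
    define W where "W = {x \<in> U. f x = 0}"
    have sub: "subspace W"
      using insert.prems(1) unfolding W_def
      by (auto simp: subspace_def blinfun.add_right blinfun.scaleR_right)
    have "e - e f *\<^sub>R ev \<in> biannihilator W"
      unfolding annihilator_def
    proof (intro CollectI ballI)
      fix h :: "'a dual" assume "h \<in> {f. \<forall>x\<in>W. blinfun_apply f x = 0}"
      then have h: "h x = 0" if "x \<in> U" "f x = 0" for x using that by (auto simp: W_def)
      have "h x - h u * f x = 0" if x: "x \<in> U" for x
      proof -
        have "x - f x *\<^sub>R u \<in> U" using x u insert.prems(1) by (intro subspace_diff subspace_scale)
        then have "h (x - f x *\<^sub>R u) = 0" by (rule h) (simp add: blinfun.diff_right blinfun.scaleR_right u)
        then show ?thesis by (simp add: blinfun.diff_right blinfun.scaleR_right)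
      qed
      then have "h - h u *\<^sub>R f \<in> annihilator blinfun_apply U"
        by (simp add: annihilator_def blinfun.diff_left blinfun.scaleR_left)
      then have "e (h - h u *\<^sub>R f) = 0" using insert.prems(2) unfolding annihilator_def by blast
      then show "(e - e f *\<^sub>R ev) h = 0"
        by (simp add: blinfun.diff_left blinfun.diff_right blinfun.scaleR_left blinfun.scaleR_right ev)
    qed
    from insert.IH[OF sub this] obtain x where x: "x \<in> W" "\<forall>g\<in>F. blinfun_apply g x = (e - e f *\<^sub>R ev) g" by blast
    have "x + e f *\<^sub>R u \<in> U"
      using x(1) u insert.prems(1) by (auto simp: W_def intro!: subspace_add subspace_scale)
    moreover have "f (x + e f *\<^sub>R u) = e f"
      using x(1) u by (simp add: W_def blinfun.add_right blinfun.scaleR_right)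
    moreover have "g (x + e f *\<^sub>R u) = e g" if "g \<in> F" for g
      using x(2) that by (simp add: blinfun.add_right blinfun.scaleR_right blinfun.diff_left blinfun.scaleR_left ev)
    ultimately show ?thesis by (intro bexI[of _ "x + e f *\<^sub>R u"]) auto
  qed
qed

text \<open>
  Each norm constraint is added by separating a convex set from a ball in the space itself; keeping
  the interpolation exact on arbitrary finite sets of functionals makes the separating
  functional available to the induction hypothesis.
\<close>

lemma local_reflexivity_tuple:
  fixes e :: "'j \<Rightarrow> 'a::real_normed_vector bidual" and A :: "('j \<Rightarrow> real) set" and F :: "'a dual set"
  assumes J: "finite J" and U: "\<And>j. j \<in> J \<Longrightarrow> subspace (U j)"
    and e: "\<And>j. j \<in> J \<Longrightarrow> e j \<in> biannihilator (U j)"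
    and \<epsilon>: "\<epsilon> > 0" and A: "finite A" and F: "finite F"
  shows "\<exists>x. (\<forall>j\<in>J. x j \<in> U j \<and> (\<forall>f\<in>F. blinfun_apply f (x j) = e j f)) \<and>
    (\<forall>a\<in>A. norm (\<Sum>j\<in>J. a j *\<^sub>R x j) < norm (\<Sum>j\<in>J. a j *\<^sub>R e j) + \<epsilon>)"
  using A F
proof (induction A arbitrary: F rule: finite_induct)
  case empty
  have "\<forall>j\<in>J. \<exists>x. x \<in> U j \<and> (\<forall>f\<in>F. blinfun_apply f x = e j f)"
    using bidual_interpolation[OF empty U e] by blast
  then show ?case by (auto dest: bchoice)
next
  case (insert a A)
  define P where "P x \<longleftrightarrow> (\<forall>j\<in>J. x j \<in> U j \<and> (\<forall>f\<in>F. blinfun_apply f (x j) = e j f)) \<and>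
    (\<forall>a\<in>A. norm (\<Sum>j\<in>J. a j *\<^sub>R x j) < norm (\<Sum>j\<in>J. a j *\<^sub>R e j) + \<epsilon>)" for x
  \<comment> \<open>All values of the new combination over tuples that already satisfy the earlier
    constraints; the new constraint asks that this convex set meet the open ball of radius
    \<open>c\<close>.\<close>
  define D where "D = {\<Sum>j\<in>J. a j *\<^sub>R x j | x. P x}"
  define c where "c = norm (\<Sum>j\<in>J. a j *\<^sub>R e j) + \<epsilon>"
  have c: "c > 0" using \<epsilon> by (simp add: c_def add_nonneg_pos)
  have comb: "(\<Sum>j\<in>J. b j *\<^sub>R (s *\<^sub>R x j + t *\<^sub>R y j)) = s *\<^sub>R (\<Sum>j\<in>J. b j *\<^sub>R x j) + t *\<^sub>R (\<Sum>j\<in>J. b j *\<^sub>R y j)"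
    for s t :: real and b and x y :: "'j \<Rightarrow> 'a"
    by (simp add: scaleR_add_right sum.distrib scaleR_sum_right mult.commute)
  have "convex D"
  proof (rule convexI)
    fix v w and s t :: real assume "v \<in> D" "w \<in> D" and st: "0 \<le> s" "0 \<le> t" "s + t = 1"
    then obtain x y where x: "P x" "v = (\<Sum>j\<in>J. a j *\<^sub>R x j)" and y: "P y" "w = (\<Sum>j\<in>J. a j *\<^sub>R y j)"
      unfolding D_def by blast
    have "P (\<lambda>j. s *\<^sub>R x j + t *\<^sub>R y j)"
      unfolding P_def
    proof (intro conjI ballI)
      fix j assume j: "j \<in> J"
      show "s *\<^sub>R x j + t *\<^sub>R y j \<in> U j"
        using x(1) y(1) j U[OF j] by (auto simp: P_def intro!: subspace_add subspace_scale)
      fix f assume "f \<in> F"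
      then have "f (s *\<^sub>R x j + t *\<^sub>R y j) = (s + t) * e j f"
        using x(1) y(1) j by (simp add: P_def blinfun.add_right blinfun.scaleR_right algebra_simps)
      then show "f (s *\<^sub>R x j + t *\<^sub>R y j) = e j f" by (simp add: st)
    next
      fix b assume b: "b \<in> A"
      let ?r = "norm (\<Sum>j\<in>J. b j *\<^sub>R e j) + \<epsilon>"
      have "(\<Sum>j\<in>J. b j *\<^sub>R x j) \<in> ball 0 ?r" "(\<Sum>j\<in>J. b j *\<^sub>R y j) \<in> ball 0 ?r"
        using x(1) y(1) b by (auto simp: P_def)
      from convexD[OF convex_ball this st]
      show "norm (\<Sum>j\<in>J. b j *\<^sub>R (s *\<^sub>R x j + t *\<^sub>R y j)) < ?r"
        unfolding comb by simp
    qed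
    then show "s *\<^sub>R v + t *\<^sub>R w \<in> D"
      unfolding D_def x(2) y(2) comb[symmetric]
      by (intro CollectI exI[of _ "\<lambda>j. s *\<^sub>R x j + t *\<^sub>R y j"]) simp
  qed
  moreover have "D \<noteq> {}" using insert.IH[OF insert.prems] by (auto simp: D_def P_def)
  moreover have "\<exists>w\<in>D. norm w < c"
  proof (rule ccontr)
    assume "\<not> ?thesis"
    then obtain g :: "'a dual" where g: "norm g \<le> 1" "\<And>w. w \<in> D \<Longrightarrow> c \<le> g w"
      using separate_convex_ball[of D c] calculation c by (metis less_eq_real_def not_le)
    obtain x where x: "\<forall>j\<in>J. x j \<in> U j \<and> (\<forall>f\<in>insert g F. blinfun_apply f (x j) = e j f)"
      "\<forall>a\<in>A. norm (\<Sum>j\<in>J. a j *\<^sub>R x j) < norm (\<Sum>j\<in>J. a j *\<^sub>R e j) + \<epsilon>"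
      using insert.IH[of "insert g F"] insert.prems by blast
    then have "P x" by (simp add: P_def)
    then have "c \<le> g (\<Sum>j\<in>J. a j *\<^sub>R x j)" by (intro g(2)) (auto simp: D_def)
    also have "\<dots> = (\<Sum>j\<in>J. a j *\<^sub>R e j) g"
      using x(1) by (simp add: blinfun.sum_right blinfun.sum_left blinfun.scaleR_right blinfun.scaleR_left)
    also have "\<dots> \<le> norm (\<Sum>j\<in>J. a j *\<^sub>R e j) * norm g"
      using norm_blinfun[of "\<Sum>j\<in>J. a j *\<^sub>R e j" g] by simp
    also have "\<dots> \<le> norm (\<Sum>j\<in>J. a j *\<^sub>R e j)" using mult_left_mono[OF g(1) norm_ge_zero] by simp
    finally show False using \<epsilon> by (simp add: c_def)
  qed
  ultimately obtain x where "P x" "norm (\<Sum>j\<in>J. a j *\<^sub>R x j) < c" by (auto simp: D_def)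
  then show ?case unfolding P_def c_def by (intro exI[of _ x]) auto
qed

text \<open>The value tuples lie in a bounded box of finite dimension. Cut it into finitely many
  cubes of side \<eta> and keep one point of \<open>B\<close> per occupied cube. This supplies a net
  for a unit ball that may be far from compact.\<close>

lemma finite_net_real_functions:
  fixes p :: "'j \<Rightarrow> 'z \<Rightarrow> real"
  assumes J: "finite J" and M: "\<And>j z. j \<in> J \<Longrightarrow> z \<in> B \<Longrightarrow> \<bar>p j z\<bar> \<le> M" and \<eta>: "\<eta> > 0"
  obtains N where "finite N" and "N \<subseteq> B"
    and "\<And>z. z \<in> B \<Longrightarrow> \<exists>z'\<in>N. \<forall>j\<in>J. \<bar>p j z - p j z'\<bar> \<le> \<eta>"
proof -
  define h where "h z = restrict (\<lambda>j. \<lfloor>p j z / \<eta>\<rfloor>) J" for z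
  have "h ` B \<subseteq> (\<Pi>\<^sub>E j\<in>J. {\<lfloor>- M / \<eta>\<rfloor>..\<lfloor>M / \<eta>\<rfloor>})"
  proof (intro image_subsetI PiE_I)
    fix z j assume z: "z \<in> B" and j: "j \<in> J"
    have "- M \<le> p j z" "p j z \<le> M" using abs_le_D1[OF M[OF j z]] abs_le_D2[OF M[OF j z]] by linarith+
    then have "- M / \<eta> \<le> p j z / \<eta>" "p j z / \<eta> \<le> M / \<eta>"
      using divide_right_mono[of "- M" "p j z" \<eta>] divide_right_mono[of "p j z" M \<eta>] \<eta> by simp_all
    then show "h z j \<in> {\<lfloor>- M / \<eta>\<rfloor>..\<lfloor>M / \<eta>\<rfloor>}" using j by (simp add: h_def floor_mono)
  qed (simp add: h_def)
  then have fin: "finite (h ` B)" by (rule finite_subset) (simp add: finite_PiE J)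
  obtain N where N: "N \<subseteq> B" "finite N" "h ` B = h ` N"
    using finite_subset_image[OF fin subset_refl] by auto
  have "\<exists>z'\<in>N. \<forall>j\<in>J. \<bar>p j z - p j z'\<bar> \<le> \<eta>" if "z \<in> B" for z
  proof -
    have "h z \<in> h ` N" using imageI[OF that, of h] by (simp only: N(3))
    then obtain z' where z': "z' \<in> N" "h z = h z'" by (rule imageE)
    have "\<bar>p j z - p j z'\<bar> \<le> \<eta>" if j: "j \<in> J" for j
    proof -
      have "\<lfloor>p j z / \<eta>\<rfloor> = \<lfloor>p j z' / \<eta>\<rfloor>" using fun_cong[OF z'(2), of j] j by (simp add: h_def)
      then have "\<bar>p j z / \<eta> - p j z' / \<eta>\<bar> \<le> 1" by linarith
      then have "\<bar>p j z - p j z'\<bar> / \<eta> \<le> 1" using \<eta> by (simp add: diff_divide_distrib[symmetric])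
      then show ?thesis using \<eta> by (simp add: field_simps)
    qed
    then show ?thesis using z'(1) by blast
  qed
  with N(2,1) show thesis by (rule that)
qed

text \<open>The operator sees the unit ball only through the finitely many functionals
  \<open>p j\<close>, so a finite net in their values reduces an operator norm bound to finitely
  many norm constraints on the tuple.\<close>

theorem local_reflexivity_operator:
  fixes e :: "'j \<Rightarrow> 'a::real_normed_vector bidual" and F :: "'a dual set"
    and p :: "'j \<Rightarrow> 'z::real_normed_vector dual"
  assumes J: "finite J" and U: "\<And>j. j \<in> J \<Longrightarrow> subspace (U j)"
    and e: "\<And>j. j \<in> J \<Longrightarrow> e j \<in> biannihilator (U j)"
    and bound: "\<And>z. norm (\<Sum>j\<in>J. p j z *\<^sub>R e j) \<le> c * norm z"
    and c: "c \<ge> 0" and \<epsilon>: "\<epsilon> > 0" and F: "finite F"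
  shows "\<exists>x. (\<forall>j\<in>J. x j \<in> U j \<and> (\<forall>f\<in>F. blinfun_apply f (x j) = e j f)) \<and>
    (\<forall>z. norm (\<Sum>j\<in>J. p j z *\<^sub>R x j) \<le> (c + \<epsilon>) * norm z)"
proof -
  \<comment> \<open>The cap 1 gives norm (x j) \<le> norm (e j) + 1; the cap \<epsilon>/2 leaves the
    other half for the net error.\<close>
  define \<delta> where "\<delta> = min 1 (\<epsilon> / 2)"
  have \<delta>: "\<delta> > 0" "\<delta> \<le> 1" "\<delta> \<le> \<epsilon> / 2" using \<epsilon> by (auto simp: \<delta>_def)
  define s where "s = (\<Sum>j\<in>J. norm (e j) + 1)"
  have s: "s \<ge> 0" by (auto simp: s_def intro: sum_nonneg)
  \<comment> \<open>The net error is at most \<eta> * s; the denominator s + 1 also covers an empty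
    \<open>J\<close>.\<close>
  define \<eta> where "\<eta> = \<epsilon> / 2 / (s + 1)"
  have \<eta>: "\<eta> > 0" using s \<epsilon> by (simp add: \<eta>_def)
  have "\<bar>p j z\<bar> \<le> (\<Sum>j\<in>J. norm (p j))" if "j \<in> J" "z \<in> cball 0 1" for j z
  proof -
    have "norm (p j z) \<le> norm (p j) * norm z" by (rule norm_blinfun)
    also have "\<dots> \<le> norm (p j)" using that(2) mult_left_mono[of "norm z" 1 "norm (p j)"] by simp
    also have "\<dots> \<le> (\<Sum>j\<in>J. norm (p j))" using J that(1) by (intro member_le_sum) auto
    finally show ?thesis by simp
  qed
  then obtain N where N: "finite N" "N \<subseteq> cball 0 1"
    "\<And>z. z \<in> cball 0 1 \<Longrightarrow> \<exists>z'\<in>N. \<forall>j\<in>J. \<bar>p j z - p j z'\<bar> \<le> \<eta>"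
    using finite_net_real_functions[OF J _ \<eta>, of "cball 0 1" "\<lambda>j. blinfun_apply (p j)"] by metis
  \<comment> \<open>Besides the coefficient vectors of the net points, the unit vectors: their
    constraints bound every \<open>x j\<close> by a constant fixed before the mesh \<eta>.\<close>
  define A where "A = (\<lambda>z j. p j z) ` N \<union> (\<lambda>i j. if j = i then 1 else 0) ` J"
  have "finite A" using N(1) J by (simp add: A_def)
  then have "\<exists>x. (\<forall>j\<in>J. x j \<in> U j \<and> (\<forall>f\<in>F. blinfun_apply f (x j) = e j f)) \<and>
      (\<forall>a\<in>A. norm (\<Sum>j\<in>J. a j *\<^sub>R x j) < norm (\<Sum>j\<in>J. a j *\<^sub>R e j) + \<delta>)"
    by (intro local_reflexivity_tuple J U e \<delta>(1) F)
  then obtain x where x: "\<forall>j\<in>J. x j \<in> U j \<and> (\<forall>f\<in>F. blinfun_apply f (x j) = e j f)"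
    and xA: "\<And>a. a \<in> A \<Longrightarrow> norm (\<Sum>j\<in>J. a j *\<^sub>R x j) < norm (\<Sum>j\<in>J. a j *\<^sub>R e j) + \<delta>"
    by blast
  have delta_sum: "(\<Sum>j\<in>J. (if j = i then 1 else 0) *\<^sub>R v j) = v i" if "i \<in> J" for i and v :: "'j \<Rightarrow> 'v::real_vector"
    using that J by (simp add: if_distrib[of "\<lambda>r. r *\<^sub>R _"] sum.delta cong: if_cong)
  have xnorm: "norm (x i) \<le> norm (e i) + 1" if "i \<in> J" for i
    using xA[of "\<lambda>j. if j = i then 1 else 0"] delta_sum[OF that, of x] delta_sum[OF that, of e] \<delta>(2) that
    by (auto simp: A_def)
  have ball_bound: "norm (\<Sum>j\<in>J. p j z *\<^sub>R x j) \<le> c + \<epsilon>" if z: "z \<in> cball 0 1" for z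
  proof -
    obtain z' where z': "z' \<in> N" "\<forall>j\<in>J. \<bar>p j z - p j z'\<bar> \<le> \<eta>" using N(3)[OF z] by blast
    have z'_bound: "norm (\<Sum>j\<in>J. p j z' *\<^sub>R e j) \<le> c"
      using order_trans[OF bound[of z'] mult_left_mono[of "norm z'" 1 c]] N(2) z'(1) c by auto
    have "(\<Sum>j\<in>J. p j z *\<^sub>R x j) = (\<Sum>j\<in>J. p j z' *\<^sub>R x j) + (\<Sum>j\<in>J. (p j z - p j z') *\<^sub>R x j)"
      by (simp add: sum.distrib[symmetric] scaleR_add_left[symmetric])
    also have "norm \<dots> \<le> norm (\<Sum>j\<in>J. p j z' *\<^sub>R x j) + norm (\<Sum>j\<in>J. (p j z - p j z') *\<^sub>R x j)"
      by (rule norm_triangle_ineq)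
    also have "norm (\<Sum>j\<in>J. (p j z - p j z') *\<^sub>R x j) \<le> (\<Sum>j\<in>J. \<eta> * (norm (e j) + 1))"
      by (rule sum_norm_le) (use z'(2) xnorm \<eta> in \<open>auto intro!: mult_mono\<close>)
    also have "\<dots> = \<eta> * s" by (simp add: s_def sum_distrib_left)
    also have "\<dots> \<le> \<epsilon> / 2" using s \<epsilon> by (simp add: \<eta>_def field_simps)
    also have "norm (\<Sum>j\<in>J. p j z' *\<^sub>R x j) \<le> norm (\<Sum>j\<in>J. p j z' *\<^sub>R e j) + \<epsilon> / 2"
      using xA[of "\<lambda>j. p j z'"] z'(1) \<delta>(3) by (auto simp: A_def)
    finally show ?thesis using z'_bound by simp
  qed
  show ?thesis
  proof (intro exI[of _ x] conjI allI)
    fix z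
    show "norm (\<Sum>j\<in>J. p j z *\<^sub>R x j) \<le> (c + \<epsilon>) * norm z"
    proof (cases "z = 0")
      case False
      have "(\<Sum>j\<in>J. p j (sgn z) *\<^sub>R x j) = (1 / norm z) *\<^sub>R (\<Sum>j\<in>J. p j z *\<^sub>R x j)"
        by (simp add: sgn_div_norm blinfun.scaleR_right scaleR_sum_right divide_inverse)
      with ball_bound[of "sgn z"] False show ?thesis by (simp add: norm_sgn field_simps)
    qed (simp add: blinfun.zero_right)
  qed (rule x)
qed

section \<open>Finite-rank operators leaving a chain invariant\<close>

lemma functional_off_finite_span:
  fixes e :: "'a::real_normed_vector"
  assumes "finite B" and "e \<notin> span B"
  shows "\<exists>\<phi> :: 'a dual. (\<forall>b\<in>B. \<phi> b = 0) \<and> \<phi> e = 1"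
  using assms
proof (induction B arbitrary: e rule: finite_induct)
  case empty
  then have e: "norm e \<noteq> 0" by simp
  obtain g :: "'a dual" where "g e = norm e" by (rule norming_functional)
  then show ?case using e by (intro exI[of _ "(1 / norm e) *\<^sub>R g"]) (simp add: blinfun.scaleR_left)
next
  case (insert b B)
  show ?case
  proof (cases "b \<in> span B")
    case True
    then have "e \<notin> span B" using insert.prems by (simp add: span_redundant)
    from insert.IH[OF this] obtain \<phi> :: "'a dual" where \<phi>: "\<forall>b\<in>B. \<phi> b = 0" "\<phi> e = 1" by blast
    have "\<phi> b = 0"
      using True \<phi>(1) linear_eq_0_on_span[of "blinfun_apply \<phi>" B b]
      by (simp add: bounded_linear.linear[OF blinfun.bounded_linear_right])
    then show ?thesis using \<phi> by auto
  next
    case False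
    from insert.IH[OF this] obtain \<psi> :: "'a dual" where \<psi>: "\<forall>b\<in>B. \<psi> b = 0" "\<psi> b = 1" by blast
    have "e - \<psi> e *\<^sub>R b \<notin> span B" using insert.prems by (auto simp: span_insert)
    from insert.IH[OF this] obtain \<phi> :: "'a dual" where \<phi>: "\<forall>b\<in>B. \<phi> b = 0" "\<phi> (e - \<psi> e *\<^sub>R b) = 1"
      by blast
    show ?thesis
      using \<phi> \<psi> by (intro exI[of _ "\<phi> - \<phi> b *\<^sub>R \<psi>"])
        (auto simp: blinfun.diff_left blinfun.diff_right blinfun.scaleR_left blinfun.scaleR_right algebra_simps)
  qed
qed

text \<open>The subfamilies of members containing a given point are nested, so a finite set has a
  point lying in the fewest members. This point becomes the vector of the rank-one term to be split
  off.\<close>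

lemma chain_maximal_element:
  assumes "finite B" and "B \<noteq> {}"
    and chain: "\<And>V W. V \<in> \<W> \<Longrightarrow> W \<in> \<W> \<Longrightarrow> V \<subseteq> W \<or> W \<subseteq> V"
  shows "\<exists>b\<in>B. \<forall>W\<in>\<W>. b \<in> W \<longrightarrow> B \<subseteq> W"
  using assms(1,2)
proof (induction B rule: finite_ne_induct)
  case (insert x B)
  then obtain b where b: "b \<in> B" "\<forall>W\<in>\<W>. b \<in> W \<longrightarrow> B \<subseteq> W" by blast
  show ?case
  proof (cases "\<forall>W\<in>\<W>. b \<in> W \<longrightarrow> x \<in> W")
    case True
    then show ?thesis using b by blast
  next
    case False
    then obtain V where V: "V \<in> \<W>" "b \<in> V" "x \<notin> V" by blast
    have "insert x B \<subseteq> W" if W: "W \<in> \<W>" "x \<in> W" for W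
      using chain[OF V(1) W(1)] V W b(2) by blast
    then show ?thesis by blast
  qed
qed auto

text \<open>
  A top rank-one term is split off: the union of those traces \<open>W \<inter> span B\<close> that miss some element
  of \<open>B\<close> is a proper subspace of \<open>span B\<close>, so it lies in a hyperplane.
\<close>

lemma finite_rank_chain_decomposition:
  fixes S :: "'z::real_normed_vector \<Rightarrow> 'z"
  assumes "finite B" and "bounded_linear S" and "range S \<subseteq> span B"
    and sub: "\<And>W. W \<in> \<W> \<Longrightarrow> subspace W"
    and chain: "\<And>V W. V \<in> \<W> \<Longrightarrow> W \<in> \<W> \<Longrightarrow> V \<subseteq> W \<or> W \<subseteq> V"
    and "\<And>W. W \<in> \<W> \<Longrightarrow> S ` W \<subseteq> W"
  shows "\<exists>(n::nat) (s :: nat \<Rightarrow> 'z dual) e. (\<forall>z. S z = (\<Sum>j<n. s j z *\<^sub>R e j)) \<and>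
    (\<forall>j<n. \<forall>W\<in>\<W>. e j \<in> W \<or> (\<forall>z\<in>W. s j z = 0))"
  using assms(1,2,3,6)
proof (induction "card B" arbitrary: B S rule: less_induct)
  case less
  note finB = less.prems(1) and bl = less.prems(2) and range = less.prems(3) and inv = less.prems(4)
  show ?case
  proof (cases "B = {}")
    case True
    then have "S z = 0" for z using range by auto
    then show ?thesis by (intro exI[of _ 0]) simp
  next
    case False
    from chain_maximal_element[OF finB False, of \<W>] chain
    obtain b where b: "b \<in> B" "\<And>W. W \<in> \<W> \<Longrightarrow> b \<in> W \<Longrightarrow> B \<subseteq> W" by blast
    \<comment> \<open>The zero vector is added separately, since possibly every member of the chain
      contains \<open>B\<close>.\<close>
    define E where "E = {0} \<union> \<Union>{W \<inter> span B | W. W \<in> \<W> \<and> \<not> B \<subseteq> W}"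
    have E_I: "x \<in> E" if "x \<in> W" "x \<in> span B" "W \<in> \<W>" "\<not> B \<subseteq> W" for x W
      using that unfolding E_def by blast
    have E_E: "x = 0 \<or> (\<exists>W\<in>\<W>. \<not> B \<subseteq> W \<and> x \<in> W \<inter> span B)" if "x \<in> E" for x
      using that unfolding E_def by blast
    have subE: "subspace E"
    proof (rule subspaceI)
      show "0 \<in> E" by (simp add: E_def)
      show "c *\<^sub>R x \<in> E" if "x \<in> E" for c x
        using E_E[OF that] E_I[of "c *\<^sub>R x"] sub by (auto simp: \<open>0 \<in> E\<close> intro: subspace_scale span_scale)
      show "x + y \<in> E" if x: "x \<in> E" and y: "y \<in> E" for x y
      proof (cases "x = 0 \<or> y = 0")
        case False
        obtain V where V: "V \<in> \<W>" "\<not> B \<subseteq> V" "x \<in> V" "x \<in> span B" using E_E[OF x] False by blast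
        obtain W where W: "W \<in> \<W>" "\<not> B \<subseteq> W" "y \<in> W" "y \<in> span B" using E_E[OF y] False by blast
        have sp: "x + y \<in> span B" using V W by (intro span_add)
        from chain[OF V(1) W(1)] show ?thesis
        proof
          assume "V \<subseteq> W"
          then show ?thesis using V W sub by (intro E_I[OF _ sp W(1,2)] subspace_add) auto
        next
          assume "W \<subseteq> V"
          then show ?thesis using V W sub by (intro E_I[OF _ sp V(1,2)] subspace_add) auto
        qed
      qed (use x y in auto)
    qed
    have EB: "E \<subseteq> span B" using E_E span_zero by blast
    show ?thesis
    proof (cases "b \<in> E")
      case True
      have "\<not> (\<exists>W\<in>\<W>. \<not> B \<subseteq> W \<and> b \<in> W \<inter> span B)" using b(2) by blast
      then have "b = 0" using E_E[OF True] by blast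
      then have "span (B - {b}) = span B" using span_delete_0[of B] by simp
      then have "range S \<subseteq> span (B - {b})" using range by simp
      moreover have "card (B - {b}) < card B" using finB b(1) by (rule card_Diff1_less)
      ultimately show ?thesis using less.hyps[of "B - {b}" S] finB bl inv by blast
    next
      case False
      obtain C where C: "C \<subseteq> E" "independent C" "E \<subseteq> span C"
        using maximal_independent_subset[of E] by blast
      have spanC: "span C = E"
        using C(1,3) span_minimal[OF C(1) subE] by blast
      have "independent (insert b C)" using C(2) False spanC by (simp add: independent_insert)
      moreover have "insert b C \<subseteq> span B" using C(1) EB b(1) span_superset by blast
      \<comment> \<open>A basis of \<open>E\<close> together with \<open>b\<close> is extended to a
        basis of span B; removing \<open>b\<close> leaves a hyperplane that contains
        \<open>E\<close> and misses \<open>b\<close>.\<close>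
      ultimately obtain D where D: "insert b C \<subseteq> D" "D \<subseteq> span B" "independent D" "span B \<subseteq> span D"
        using maximal_independent_subset_extend[of "insert b C" "span B"] by blast
      have fD: "finite D" "card D \<le> card B" using independent_span_bound[OF finB D(3,2)] by auto
      define H where "H = D - {b}"
      have finH: "finite H" using fD by (simp add: H_def)
      have bH: "b \<notin> span H" using D(1,3) unfolding H_def dependent_def by blast
      have cardH: "card H < card B"
        using card_Diff1_less[OF fD(1), of b] D(1) fD(2) by (simp add: H_def)
      have EH: "E \<subseteq> span H"
      proof -
        have "C \<subseteq> H" using D(1) spanC False span_superset[of C] by (auto simp: H_def)
        then show ?thesis using spanC span_mono by blast
      qed
      obtain \<phi> :: "'z dual" where \<phi>: "\<forall>h\<in>H. \<phi> h = 0" "\<phi> b = 1"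
        using functional_off_finite_span[OF finH bH] by blast
      have lin: "linear (blinfun_apply \<phi>)"
        by (rule bounded_linear.linear[OF blinfun.bounded_linear_right])
      have \<phi>H: "\<phi> h = 0" if "h \<in> span H" for h
        using linear_eq_0_on_span[OF lin _ that] \<phi>(1) by blast
      have \<phi>S: "bounded_linear (\<lambda>z. \<phi> (S z))"
        by (rule bounded_linear_compose[OF blinfun.bounded_linear_right bl])
      have S_span: "S z \<in> span (insert b H)" for z
        using range D(1,4) by (auto simp: H_def insert_absorb)
      \<comment> \<open>If \<open>W\<close> misses part of \<open>B\<close>, then S z lies in the
        trace of \<open>W\<close>, hence in \<open>E\<close> and in the hyperplane. So each member
        either contains \<open>b\<close> or lies in the kernel of the new functional, which gives
        the alternative for the split term and the invariance of the remainder.\<close>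
      have vanish: "\<phi> (S z) = 0" if "W \<in> \<W>" "z \<in> W" "\<not> B \<subseteq> W" for W z
        using that inv[OF that(1)] range by (intro \<phi>H subsetD[OF EH] E_I[of _ W]) auto
      define S' where "S' z = S z - \<phi> (S z) *\<^sub>R b" for z
      have blS': "bounded_linear S'"
        unfolding S'_def by (intro bounded_linear_sub bl bounded_linear_compose[OF bounded_linear_scaleR_left \<phi>S])
      have rangeS': "range S' \<subseteq> span H"
      proof (intro image_subsetI)
        fix z
        obtain k where k: "S z - k *\<^sub>R b \<in> span H" using S_span[of z] by (auto simp: span_insert)
        then have "\<phi> (S z) = k"
          using \<phi>H[OF k] by (simp add: blinfun.diff_right blinfun.scaleR_right \<phi>(2))
        then show "S' z \<in> span H" using k by (simp add: S'_def)
      qed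
      have invS': "S' ` W \<subseteq> W" if W: "W \<in> \<W>" for W
      proof (intro image_subsetI)
        fix z assume z: "z \<in> W"
        have "\<phi> (S z) *\<^sub>R b \<in> W"
        proof (cases "B \<subseteq> W")
          case True
          then show ?thesis using b(1) sub[OF W] by (intro subspace_scale) auto
        qed (use vanish[OF W z] sub[OF W] subspace_0 in auto)
        then show "S' z \<in> W" using inv[OF W] z sub[OF W] by (auto simp: S'_def intro: subspace_diff)
      qed
      from less.hyps[OF cardH finH blS' rangeS' invS']
      obtain n and s :: "nat \<Rightarrow> 'z dual" and e
        where dec: "\<forall>z. S' z = (\<Sum>j<n. s j z *\<^sub>R e j)"
          and tri: "\<forall>j<n. \<forall>W\<in>\<W>. e j \<in> W \<or> (\<forall>z\<in>W. s j z = 0)"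
        by blast
      have "S z = (\<Sum>j<Suc n. (s(n := Blinfun (\<lambda>z. \<phi> (S z)))) j z *\<^sub>R (e(n := b)) j)" for z
        using dec[rule_format, of z] by (simp add: S'_def bounded_linear_Blinfun_apply[OF \<phi>S] algebra_simps)
      moreover have "(e(n := b)) j \<in> W \<or> (\<forall>z\<in>W. (s(n := Blinfun (\<lambda>z. \<phi> (S z)))) j z = 0)"
        if "j < Suc n" "W \<in> \<W>" for j W
        using tri[rule_format, of j W] that vanish[OF that(2)] b(1)
        by (auto simp: less_Suc_eq bounded_linear_Blinfun_apply[OF \<phi>S])
      ultimately show ?thesis by blast
    qed
  qed
qed

section \<open>Real scalars\<close>

lemma annihilator_antimono: "U \<subseteq> V \<Longrightarrow> annihilator ev V \<subseteq> annihilator ev U"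
  by (auto simp: annihilator_def)

lemma subspace_annihilator: "subspace (annihilator blinfun_apply (U :: 'a::real_normed_vector set) :: 'a dual set)"
  by (auto simp: subspace_def annihilator_def blinfun.add_left blinfun.scaleR_left)

text \<open>Functionals are continuous. This is what allows the unclosed union of the
  \<open>Q n\<close> to stand in for its closure when \<open>x j\<close> is chosen.\<close>

lemma annihilator_closure:
  "annihilator blinfun_apply (closure U) = (annihilator blinfun_apply U :: 'a::real_normed_vector dual set)"
proof
  show "annihilator blinfun_apply (closure U) \<subseteq> (annihilator blinfun_apply U :: 'a dual set)"
    by (rule annihilator_antimono) (rule closure_subset)
  show "(annihilator blinfun_apply U :: 'a dual set) \<subseteq> annihilator blinfun_apply (closure U)"
  proof
    fix f :: "'a dual" assume f: "f \<in> annihilator blinfun_apply U"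
    have "closed {x. f x = 0}"
      by (intro closed_Collect_eq continuous_intros)
    then have "closure U \<subseteq> {x. f x = 0}"
      using f by (intro closure_minimal) (auto simp: annihilator_def)
    then show "f \<in> annihilator blinfun_apply (closure U)" by (auto simp: annihilator_def)
  qed
qed

lemma subspace_closure:
  fixes U :: "'a::real_normed_vector set"
  assumes "subspace U"
  shows "subspace (closure U)"
proof (rule subspaceI)
  show "0 \<in> closure U" using subspace_0[OF assms] closure_subset by blast
  show "x + y \<in> closure U" if x: "x \<in> closure U" and y: "y \<in> closure U" for x y
  proof -
    obtain f where "\<forall>n. f n \<in> U" "f \<longlonglongrightarrow> x" using x by (auto simp: closure_sequential)
    moreover obtain g where "\<forall>n. g n \<in> U" "g \<longlonglongrightarrow> y" using y by (auto simp: closure_sequential)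
    ultimately show ?thesis
      unfolding closure_sequential using assms
      by (intro exI[of _ "\<lambda>n. f n + g n"]) (auto intro: tendsto_add subspace_add)
  qed
  show "c *\<^sub>R x \<in> closure U" if x: "x \<in> closure U" for c x
  proof -
    obtain f where "\<forall>n. f n \<in> U" "f \<longlonglongrightarrow> x" using x by (auto simp: closure_sequential)
    then show ?thesis
      unfolding closure_sequential using assms
      by (intro exI[of _ "\<lambda>n. c *\<^sub>R f n"]) (auto intro: tendsto_scaleR subspace_scale)
  qed
qed

lemma subspace_nest:
  fixes Q :: "nat \<Rightarrow> 'a::real_normed_vector set"
  assumes Q: "\<And>n. subspace (Q n)" "\<And>n. Q n \<subseteq> Q (Suc n)"
  shows "subspace (\<Union>n. Q n)" and "W \<in> scheme_nest Q \<Longrightarrow> subspace W"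
proof -
  have mono: "Q m \<subseteq> Q n" if "m \<le> n" for m n
    using that Q(2) by (rule lift_Suc_mono_le[rotated])
  show union: "subspace (\<Union>n. Q n)"
  proof (rule subspaceI)
    show "0 \<in> (\<Union>n. Q n)" using subspace_0[OF Q(1)] by blast
    show "c *\<^sub>R x \<in> (\<Union>n. Q n)" if "x \<in> (\<Union>n. Q n)" for c x
      using that subspace_scale[OF Q(1)] by blast
    fix x y assume "x \<in> (\<Union>n. Q n)" "y \<in> (\<Union>n. Q n)"
    then obtain m n where "x \<in> Q m" "y \<in> Q n" by blast
    then have "x \<in> Q (max m n)" "y \<in> Q (max m n)" using mono[of m "max m n"] mono[of n "max m n"] by auto
    then show "x + y \<in> (\<Union>n. Q n)" using subspace_add[OF Q(1)] by blast
  qed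
  show "subspace W" if "W \<in> scheme_nest Q"
    using that Q(1) subspace_closure[OF union] by (auto simp: scheme_nest_def scheme_limit_def)
qed

text \<open>Both interpolations are exact: \<open>x j\<close> matches \<open>e j\<close> on
  \<open>Y\<close> and \<open>f j\<close> matches \<open>s j\<close> on \<open>Z\<close>, so the sum
  of y (x j) * z (f j) equals the sum of e j y * s j z.\<close>

theorem nest_local_reflexivity_exact:
  fixes Q :: "nat \<Rightarrow> 'a::real_normed_vector set" and S :: "'a bidual \<Rightarrow>\<^sub>L 'a bidual"
  assumes Q: "\<And>n. subspace (Q n)" "\<And>n. Q n \<subseteq> Q (Suc n)"
    and fin: "finite_rank scaleR (blinfun_apply S)"
    and inv: "\<And>U. U \<in> scheme_nest Q \<Longrightarrow> blinfun_apply S ` biannihilator U \<subseteq> biannihilator U"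
    and Z: "finite Z" and Y: "finite Y" and \<epsilon>: "\<epsilon> > 0"
  shows "\<exists>T :: 'a \<Rightarrow>\<^sub>L 'a. finite_rank scaleR (blinfun_apply T) \<and>
    (\<forall>U\<in>scheme_nest Q. blinfun_apply T ` U \<subseteq> U) \<and> norm T \<le> norm S + \<epsilon> \<and>
    (\<forall>z\<in>Z. \<forall>y\<in>Y. blinfun_apply z (adjoint_op T y) = blinfun_apply (blinfun_apply S z) y)"
proof -
  have mono: "Q m \<subseteq> Q n" if "m \<le> n" for m n
    using that Q(2) by (rule lift_Suc_mono_le[rotated])
  have Q_lim: "Q n \<subseteq> scheme_limit Q" for n
    using closure_subset[of "\<Union>n. Q n"] by (auto simp: scheme_limit_def)
  have nestE: "(\<exists>n. W = Q n) \<or> W = scheme_limit Q \<or> W = UNIV" if "W \<in> scheme_nest Q" for W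
    using that by (auto simp: scheme_nest_def)
  have nestI: "Q n \<in> scheme_nest Q" "scheme_limit Q \<in> scheme_nest Q" for n
    by (auto simp: scheme_nest_def)
  have nest_chain: "V \<subseteq> W \<or> W \<subseteq> V" if "V \<in> scheme_nest Q" "W \<in> scheme_nest Q" for V W
  proof -
    have "Q m \<subseteq> Q n \<or> Q n \<subseteq> Q m" for m n using mono nat_le_linear by blast
    then show ?thesis using nestE[OF that(1)] nestE[OF that(2)] Q_lim by blast
  qed
  note nest_sub = subspace_nest(2)[of Q, OF Q]

  obtain B where B: "finite B" "range (blinfun_apply S) \<subseteq> span B"
    using fin by (auto simp: finite_rank_def span_raw_def)
  have "\<exists>(n::nat) (s :: nat \<Rightarrow> 'a bidual dual) e. (\<forall>z. S z = (\<Sum>j<n. s j z *\<^sub>R e j)) \<and>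
    (\<forall>j<n. \<forall>W\<in>(\<lambda>U. biannihilator U) ` scheme_nest Q. e j \<in> W \<or> (\<forall>z\<in>W. s j z = 0))"
  proof (rule finite_rank_chain_decomposition[OF B(1) blinfun.bounded_linear_right B(2)])
    show "V \<subseteq> W \<or> W \<subseteq> V"
      if VW: "V \<in> (\<lambda>U. biannihilator U) ` scheme_nest Q" "W \<in> (\<lambda>U. biannihilator U) ` scheme_nest Q" for V W
    proof -
      obtain V' where V: "V = biannihilator V'" "V' \<in> scheme_nest Q" using VW(1) by (rule imageE)
      obtain W' where W: "W = biannihilator W'" "W' \<in> scheme_nest Q" using VW(2) by (rule imageE)
      from nest_chain[OF V(2) W(2)] show ?thesis
        unfolding V(1) W(1) by (elim disjE) (simp_all add: annihilator_antimono)
    qed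
  qed (use inv subspace_annihilator in auto)
  then obtain n :: nat and s :: "nat \<Rightarrow> 'a bidual dual" and e
    where S: "\<And>z. S z = (\<Sum>j<n. s j z *\<^sub>R e j)"
      and tri: "\<And>j U. j < n \<Longrightarrow> U \<in> scheme_nest Q \<Longrightarrow>
        e j \<in> biannihilator U \<or> (\<forall>z\<in>biannihilator U. s j z = 0)"
    by auto

  \<comment> \<open>Taking the least index places \<open>U j\<close> inside every \<open>Q k\<close>
    whose biannihilator contains \<open>e j\<close>; this is used once \<open>x j\<close> has been
    located.\<close>
  define U where "U j = (if \<exists>k. e j \<in> biannihilator (Q k) then Q (LEAST k. e j \<in> biannihilator (Q k))
    else if e j \<in> biannihilator (scheme_limit Q) then (\<Union>k. Q k) else UNIV)" for j
  have U_sub: "subspace (U j)" for j using Q(1) subspace_nest(1)[of Q, OF Q] by (simp add: U_def)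
  have eU: "e j \<in> biannihilator (U j)" for j
  proof (cases "\<exists>k. e j \<in> biannihilator (Q k)")
    case True
    then show ?thesis unfolding U_def by (simp only: if_True) (rule LeastI_ex)
  next
    case False
    have "biannihilator (scheme_limit Q) = biannihilator (\<Union>k. Q k)"
      by (simp add: scheme_limit_def annihilator_closure)
    moreover have "e j \<in> biannihilator UNIV"
    proof -
      have zero: "f = 0" if "f \<in> annihilator blinfun_apply UNIV" for f :: "'a dual"
        using that by (intro blinfun_eqI) (simp add: annihilator_def)
      then show ?thesis unfolding annihilator_def[of _ "annihilator _ _"]
        by (auto dest!: zero simp: blinfun.zero_right)
    qed
    ultimately show ?thesis using False by (simp add: U_def)
  qed
  have e_bound: "norm (\<Sum>j<n. s j z *\<^sub>R e j) \<le> norm S * norm z" for z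
    using norm_blinfun[of S z] by (simp add: S)
  obtain x where x: "\<forall>j\<in>{..<n}. x j \<in> U j \<and> (\<forall>y\<in>Y. blinfun_apply y (x j) = e j y)"
    and x_bound: "\<forall>z. norm (\<Sum>j<n. s j z *\<^sub>R x j) \<le> (norm S + \<epsilon> / 2) * norm z"
    using local_reflexivity_operator[OF finite_lessThan U_sub eU e_bound norm_ge_zero half_gt_zero[OF \<epsilon>] Y]
    by blast
  have xU: "x j \<in> U j" if "j < n" for j using x that by simp

  \<comment> \<open>The set \<open>G\<close> has to contain each nest member that misses
    \<open>x j\<close>, because \<open>f j\<close> must vanish there, yet be small enough for
    \<open>s j\<close> to vanish on its biannihilator.\<close>
  have "\<exists>G. (\<forall>z\<in>biannihilator G. s j z = 0) \<and> (\<forall>W\<in>scheme_nest Q. x j \<in> W \<or> W \<subseteq> G)" if j: "j < n" for j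
  proof (cases "\<exists>k. x j \<in> Q k")
    case True
    define m where "m = (LEAST k. x j \<in> Q k)"
    have m: "x j \<in> Q m" using True unfolding m_def by (rule LeastI_ex)
    have m_le: "x j \<in> Q k \<longleftrightarrow> m \<le> k" for k
      using m mono[of m k] Least_le[of "\<lambda>k. x j \<in> Q k" k] by (auto simp: m_def)
    show ?thesis
    proof (cases m)
      \<comment> \<open>Here \<open>x j\<close> lies in every nest member, so \<open>f j\<close> is
        unconstrained: the empty set is annihilated by all functionals and its biannihilator is
        zero.\<close>
      case 0
      have "x j \<in> W" if "W \<in> scheme_nest Q" for W
        using nestE[OF that] m_le Q_lim m 0 by auto
      moreover have zero: "z = 0" if "z \<in> biannihilator {}" for z :: "'a bidual"
        using that by (intro blinfun_eqI) (simp add: annihilator_def)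
      ultimately show ?thesis by (intro exI[of _ "{}"]) (auto dest!: zero simp: blinfun.zero_right)
    next
      case (Suc k)
      \<comment> \<open>Minimality of m = Suc k excludes \<open>x j\<close> from \<open>Q k\<close>,
        whereas \<open>e j\<close> in its biannihilator would have put \<open>U j\<close> inside
        \<open>Q k\<close>. The argument includes the case where \<open>U j\<close> is the whole
        union, so vanishing on a single \<open>Q k\<close> is enough even there.\<close>
      have "e j \<notin> biannihilator (Q k)"
      proof
        assume k: "e j \<in> biannihilator (Q k)"
        then have "U j \<subseteq> Q k" using Least_le[of "\<lambda>k. e j \<in> biannihilator (Q k)" k] mono by (auto simp: U_def)
        then show False using xU[OF j] m_le[of k] Suc by auto
      qed
      then have "\<forall>z\<in>biannihilator (Q k). s j z = 0" using tri[OF j nestI(1)] by blast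
      moreover have "x j \<in> W \<or> W \<subseteq> Q k" if "W \<in> scheme_nest Q" for W
      proof -
        have "x j \<in> Q i \<or> Q i \<subseteq> Q k" for i using m_le[of i] mono[of i k] Suc by auto
        then show ?thesis using nestE[OF that] Q_lim m by blast
      qed
      ultimately show ?thesis by blast
    qed
  next
    case False
    \<comment> \<open>With \<open>x j\<close> in no \<open>Q k\<close>, the only remaining choice
      for \<open>U j\<close> is \<open>UNIV\<close>.\<close>
    have "e j \<notin> biannihilator (scheme_limit Q)"
      using False xU[OF j] by (auto simp: U_def split: if_splits)
    then have "\<forall>z\<in>biannihilator (scheme_limit Q). s j z = 0" using tri[OF j nestI(2)] by blast
    moreover have "x j \<in> W \<or> W \<subseteq> scheme_limit Q" if "W \<in> scheme_nest Q" for W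
      using nestE[OF that] Q_lim by blast
    ultimately show ?thesis by blast
  qed
  then obtain G where G: "\<And>j z. j < n \<Longrightarrow> z \<in> biannihilator (G j) \<Longrightarrow> s j z = 0"
    and GW: "\<And>j W. j < n \<Longrightarrow> W \<in> scheme_nest Q \<Longrightarrow> x j \<in> W \<or> W \<subseteq> G j"
    by metis
  define V :: "nat \<Rightarrow> 'a dual set" where "V j = annihilator blinfun_apply (G j)" for j
  \<comment> \<open>Evaluation at \<open>x j\<close>: over the dual space, \<open>p j\<close> and
    \<open>s j\<close> now take the roles that \<open>s j\<close> and \<open>e j\<close> had
    before.\<close>
  define p :: "nat \<Rightarrow> 'a bidual" where "p j = Blinfun (\<lambda>y. blinfun_apply y (x j))" for j
  have p: "p j y = y (x j)" for j and y :: "'a dual"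
    by (simp add: p_def bounded_linear_Blinfun_apply blinfun.bounded_linear_left)
  have V_sub: "subspace (V j)" for j by (simp add: V_def subspace_annihilator)
  have sV: "s j \<in> biannihilator (V j)" if "j \<in> {..<n}" for j
    using G[of j] that by (simp add: V_def annihilator_def[of _ "annihilator _ (annihilator _ _)"])
  \<comment> \<open>This map is the adjoint of the one sending z to the sum of
    \<open>s j z *\<^sub>R x j\<close>, so it inherits the bound just obtained.\<close>
  have pbound: "norm (\<Sum>j<n. p j y *\<^sub>R s j) \<le> (norm S + \<epsilon> / 2) * norm y" for y
  proof (rule norm_blinfun_bound)
    fix z
    have "(\<Sum>j<n. p j y *\<^sub>R s j) z = y (\<Sum>j<n. s j z *\<^sub>R x j)"
      by (simp add: blinfun.sum_left blinfun.sum_right blinfun.scaleR_left blinfun.scaleR_right p mult.commute)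
    also have "norm \<dots> \<le> norm y * norm (\<Sum>j<n. s j z *\<^sub>R x j)" by (rule norm_blinfun)
    also have "\<dots> \<le> norm y * ((norm S + \<epsilon> / 2) * norm z)" by (rule mult_left_mono[OF x_bound[rule_format]]) simp
    finally show "norm ((\<Sum>j<n. p j y *\<^sub>R s j) z) \<le> (norm S + \<epsilon> / 2) * norm y * norm z"
      by (simp add: mult_ac)
  qed (use \<epsilon> in \<open>simp add: add_nonneg_nonneg\<close>)
  have "norm S + \<epsilon> / 2 \<ge> 0" using \<epsilon> by (simp add: add_nonneg_nonneg)
  then obtain f where f: "\<forall>j\<in>{..<n}. f j \<in> V j \<and> (\<forall>z\<in>Z. blinfun_apply z (f j) = s j z)"
    and f_bound: "\<forall>y. norm (\<Sum>j<n. p j y *\<^sub>R f j) \<le> (norm S + \<epsilon> / 2 + \<epsilon> / 2) * norm y"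
    using local_reflexivity_operator[OF finite_lessThan V_sub sV pbound _ half_gt_zero[OF \<epsilon>] Z] by blast
  have fV: "f j \<in> V j" if "j < n" for j using f that by simp

  define T where "T = Blinfun (\<lambda>v. \<Sum>j<n. f j v *\<^sub>R x j)"
  have "bounded_linear (\<lambda>v. \<Sum>j<n. f j v *\<^sub>R x j)"
    by (intro bounded_linear_sum bounded_linear_compose[OF bounded_linear_scaleR_left blinfun.bounded_linear_right])
  then have T: "T v = (\<Sum>j<n. f j v *\<^sub>R x j)" for v
    by (simp add: T_def bounded_linear_Blinfun_apply)
  have adj: "adjoint_op T y = (\<Sum>j<n. p j y *\<^sub>R f j)" for y
    by (rule blinfun_eqI)
      (simp add: adjoint_op_def T p blinfun.sum_left blinfun.sum_right blinfun.scaleR_left blinfun.scaleR_right mult.commute)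
  show ?thesis
  proof (intro exI[of _ T] conjI ballI)
    have "T v \<in> span (x ` {..<n})" for v
      unfolding T by (intro span_sum span_scale span_base) auto
    then show "finite_rank scaleR (blinfun_apply T)"
      unfolding finite_rank_def span_raw_def[symmetric] by (intro exI[of _ "x ` {..<n}"]) auto
    show "T ` W \<subseteq> W" if W: "W \<in> scheme_nest Q" for W
    proof (intro image_subsetI)
      fix v assume v: "v \<in> W"
      have "f j v *\<^sub>R x j \<in> W" if j: "j < n" for j
      proof -
        have "x j \<in> W \<or> f j v = 0"
          using GW[OF j W] fV[OF j] v by (auto simp: V_def annihilator_def)
        then show ?thesis
          using subspace_scale[OF nest_sub[OF W]] subspace_0[OF nest_sub[OF W]] by auto
      qed
      then show "T v \<in> W" unfolding T by (intro subspace_sum nest_sub[OF W]) auto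
    qed
    show "norm T \<le> norm S + \<epsilon>"
    proof (rule norm_blinfun_bound)
      fix v
      \<comment> \<open>The second replacement bounds the adjoint of \<open>T\<close>; a norming
        functional carries the bound back to \<open>T\<close>.\<close>
      obtain g :: "'a dual" where g: "norm g \<le> 1" "g (T v) = norm (T v)" by (rule norming_functional)
      have "norm (T v) = adjoint_op T g v" by (simp add: g(2) adjoint_op_def)
      also have "\<dots> \<le> norm (adjoint_op T g) * norm v"
        using norm_blinfun[of "adjoint_op T g" v] by simp
      also have "norm (adjoint_op T g) \<le> (norm S + \<epsilon>) * norm g" using f_bound[rule_format, of g] by (simp add: adj add.commute)
      also have "\<dots> \<le> norm S + \<epsilon>" using mult_left_mono[OF g(1), of "norm S + \<epsilon>"] \<epsilon> by simp
      finally show "norm (T v) \<le> (norm S + \<epsilon>) * norm v" by (simp add: mult_right_mono)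
    qed (use \<epsilon> in simp)
    show "z (adjoint_op T y) = S z y" if "z \<in> Z" "y \<in> Y" for z y
      using that by (simp add: adj S p blinfun.sum_left blinfun.sum_right blinfun.scaleR_left
          blinfun.scaleR_right x f mult.commute)
  qed
qed

section \<open>From finite to compact test sets\<close>

lemma norm_blinfun_bound_unit:
  fixes f :: "'a::real_normed_vector \<Rightarrow>\<^sub>L 'b::real_normed_vector"
  assumes "\<And>x. norm x \<le> 1 \<Longrightarrow> norm (f x) \<le> c"
  shows "norm f \<le> c"
proof (rule norm_blinfun_bound)
  show "0 \<le> c" using order_trans[OF norm_ge_zero assms[of 0]] by simp
  show "norm (f x) \<le> c * norm x" for x
    using assms[of "sgn x"]
    by (cases "x = 0") (simp_all add: norm_sgn sgn_div_norm blinfun.scaleR_right blinfun.zero_right field_simps)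
qed

lemma adjoint_pairing_le:
  fixes T :: "'a::real_normed_vector \<Rightarrow>\<^sub>L 'a"
  shows "\<bar>blinfun_apply z (adjoint_op T y)\<bar> \<le> norm T * norm z * norm y"
proof -
  have "\<bar>z (adjoint_op T y)\<bar> \<le> norm z * norm (adjoint_op T y)"
    using norm_blinfun[of z "adjoint_op T y"] by simp
  also have "\<dots> \<le> norm z * (norm y * norm T)"
    unfolding adjoint_op_def by (intro mult_left_mono norm_blinfun_compose) simp
  finally show ?thesis by (simp add: mult_ac)
qed

lemma bidual_pairing_le:
  fixes S :: "'a::real_normed_vector bidual \<Rightarrow>\<^sub>L 'a bidual"
  shows "\<bar>blinfun_apply (S z) y\<bar> \<le> norm S * norm z * norm y"
proof -
  have "\<bar>S z y\<bar> \<le> norm (S z) * norm y" using norm_blinfun[of "S z" y] by simp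
  also have "\<dots> \<le> (norm S * norm z) * norm y" by (intro mult_right_mono norm_blinfun) simp
  finally show ?thesis by simp
qed

lemma compact_bounded_net:
  fixes K :: "'a::real_normed_vector set"
  assumes "compact K" and "\<delta> > 0"
  obtains N k where "finite N" and "k \<ge> 0" and "\<And>x. x \<in> K \<Longrightarrow> norm x \<le> k"
    and "\<And>x. x \<in> K \<Longrightarrow> \<exists>x'\<in>N. norm (x - x') < \<delta>"
proof -
  obtain N where N: "finite N" "K \<subseteq> (\<Union>x\<in>N. ball x \<delta>)"
    using assms compact_eq_totally_bounded[of K] by blast
  obtain k where k: "\<And>x. x \<in> K \<Longrightarrow> norm x \<le> k"
    using compact_imp_bounded[OF assms(1)] by (auto simp: bounded_iff)
  show thesis
  proof (rule that[of N "max k 0"])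
    show "\<exists>x'\<in>N. norm (x - x') < \<delta>" if "x \<in> K" for x
      using N(2) that by (fastforce simp: dist_norm norm_minus_commute)
    show "norm x \<le> max k 0" if "x \<in> K" for x using k[OF that] by simp
  qed (use N(1) in auto)
qed

text \<open>The error is a bounded bilinear form in (z, y) that vanishes on pairs of net points, so
  it is small on the compact sets as soon as the nets are fine. Its bound has to be known before
  \<open>T\<close> exists, since the nets are an input to its construction.\<close>

theorem nest_local_reflexivity_compact:
  fixes Q :: "nat \<Rightarrow> 'a::real_normed_vector set" and S :: "'a bidual \<Rightarrow>\<^sub>L 'a bidual"
  assumes Q: "\<And>n. subspace (Q n)" "\<And>n. Q n \<subseteq> Q (Suc n)"
    and fin: "finite_rank scaleR (blinfun_apply S)"
    and inv: "\<And>U. U \<in> scheme_nest Q \<Longrightarrow> blinfun_apply S ` biannihilator U \<subseteq> biannihilator U"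
    and K: "compact K" and L: "compact L" and \<epsilon>: "\<epsilon> > 0"
  shows "\<exists>T :: 'a \<Rightarrow>\<^sub>L 'a. finite_rank scaleR (blinfun_apply T) \<and>
    (\<forall>U\<in>scheme_nest Q. blinfun_apply T ` U \<subseteq> U) \<and> norm T < norm S + \<epsilon> \<and>
    (\<forall>z\<in>K. \<forall>y\<in>L. \<bar>blinfun_apply z (adjoint_op T y) - blinfun_apply (blinfun_apply S z) y\<bar> < \<epsilon>)"
proof -
  obtain k l where k: "k \<ge> 0" "\<And>z. z \<in> K \<Longrightarrow> norm z \<le> k" and l: "l \<ge> 0" "\<And>y. y \<in> L \<Longrightarrow> norm y \<le> l"
    using compact_bounded_net[OF K zero_less_one] compact_bounded_net[OF L zero_less_one] by metis
  \<comment> \<open>Bounds norm T + norm S in advance, given that \<open>T\<close> will satisfy norm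
    T \<le> norm S + 1.\<close>
  define M where "M = 2 * norm S + 1"
  have M: "M > 0" by (simp add: M_def add_nonneg_pos)
  \<comment> \<open>Passing to net points costs at most M * \<delta> * l + M * (k + 1) * \<delta>;
    the cap 1 ensures that a net point near \<open>K\<close> has norm at most k + 1.\<close>
  define \<delta> where "\<delta> = min 1 (\<epsilon> / 2 / (M * (l + k + 1)))"
  have pos: "M * (l + k + 1) > 0" using M k(1) l(1) by simp
  have \<delta>: "\<delta> > 0" "\<delta> \<le> 1" using \<epsilon> pos by (auto simp: \<delta>_def)
  have "\<delta> \<le> \<epsilon> / 2 / (M * (l + k + 1))" by (simp add: \<delta>_def)
  then have \<delta>M: "\<delta> * (M * (l + k + 1)) \<le> \<epsilon> / 2" using pos by (simp add: pos_le_divide_eq)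
  obtain Z where Z: "finite Z" "\<And>z. z \<in> K \<Longrightarrow> \<exists>z'\<in>Z. norm (z - z') < \<delta>"
    using compact_bounded_net[OF K \<delta>(1)] by metis
  obtain Y where Y: "finite Y" "\<And>y. y \<in> L \<Longrightarrow> \<exists>y'\<in>Y. norm (y - y') < \<delta>"
    using compact_bounded_net[OF L \<delta>(1)] by metis
  have "min (\<epsilon> / 2) 1 > 0" using \<epsilon> by simp
  with nest_local_reflexivity_exact[where Q = Q and S = S, OF Q fin inv Z(1) Y(1)]
  obtain T :: "'a \<Rightarrow>\<^sub>L 'a" where T: "finite_rank scaleR (blinfun_apply T)"
    "\<forall>U\<in>scheme_nest Q. blinfun_apply T ` U \<subseteq> U"
    "norm T \<le> norm S + min (\<epsilon> / 2) 1"
    "\<forall>z\<in>Z. \<forall>y\<in>Y. blinfun_apply z (adjoint_op T y) = blinfun_apply (blinfun_apply S z) y"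
    by blast
  define d where "d z y = blinfun_apply z (adjoint_op T y) - blinfun_apply (blinfun_apply S z) y" for z y
  have d_le: "\<bar>d z y\<bar> \<le> M * norm z * norm y" for z y
  proof -
    have "\<bar>d z y\<bar> \<le> norm T * norm z * norm y + norm S * norm z * norm y"
      using adjoint_pairing_le[of z T y] bidual_pairing_le[of S z y] by (simp add: d_def)
    also have "\<dots> = (norm T + norm S) * (norm z * norm y)" by (simp add: algebra_simps)
    also have "\<dots> \<le> M * (norm z * norm y)"
      using T(3) by (intro mult_right_mono) (auto simp: M_def)
    finally show ?thesis by (simp add: mult.assoc)
  qed
  show ?thesis
  proof (intro exI[of _ T] conjI T(1,2) ballI)
    show "norm T < norm S + \<epsilon>" using T(3) \<epsilon> by auto
    fix z y assume z: "z \<in> K" and y: "y \<in> L"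
    obtain z' where z': "z' \<in> Z" "norm (z - z') < \<delta>" using Z(2)[OF z] by blast
    obtain y' where y': "y' \<in> Y" "norm (y - y') < \<delta>" using Y(2)[OF y] by blast
    have nz': "norm z' \<le> k + 1"
      using norm_triangle_sub[of z' z] k(2)[OF z] z'(2) \<delta>(2) by (simp add: norm_minus_commute)
    have "adjoint_op T (y - y') = adjoint_op T y - adjoint_op T y'"
      by (rule blinfun_eqI) (simp add: adjoint_op_def blinfun.diff_left)
    \<comment> \<open>Moving one argument at a time leaves d z' y', which is zero by exactness on
      the nets.\<close>
    then have "d z y = d (z - z') y + d z' (y - y')"
      using T(4)[rule_format, OF z'(1) y'(1)]
      by (simp add: d_def blinfun.diff_left blinfun.diff_right)
    then have "\<bar>d z y\<bar> \<le> M * norm (z - z') * norm y + M * norm z' * norm (y - y')"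
      using d_le[of "z - z'" y] d_le[of z' "y - y'"] by linarith
    also have "\<dots> \<le> M * \<delta> * l + M * (k + 1) * \<delta>"
      using z'(2) y'(2) nz' l k(1) M \<delta>(1) y by (intro add_mono mult_mono) auto
    also have "\<dots> = \<delta> * (M * (l + k + 1))" by (simp add: algebra_simps)
    also have "\<dots> < \<epsilon>" using \<delta>M \<epsilon> by linarith
    finally show "\<bar>z (adjoint_op T y) - S z y\<bar> < \<epsilon>" by (simp add: d_def)
  qed
qed

section \<open>Complex scalars\<close>

lemma bounded_linear_cblinfun: "bounded_linear (cblinfun_apply f)"
  by (simp add: cblinfun_apply.rep_eq blinfun.bounded_linear_right)

lemmas cblinfun_right_simps =
  linear_add[OF bounded_linear.linear[OF bounded_linear_cblinfun]]
  linear_diff[OF bounded_linear.linear[OF bounded_linear_cblinfun]]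
  linear_scale[OF bounded_linear.linear[OF bounded_linear_cblinfun]]

lemma cblinfun_scaleC_right: "cblinfun_apply f (c *\<^sub>C x) = c *\<^sub>C cblinfun_apply f x"
  by transfer simp

lemma cblinfun_eqI: "(\<And>x. cblinfun_apply f x = cblinfun_apply g x) \<Longrightarrow> f = g"
  by transfer (rule blinfun_eqI)

lemma cblinfun_left_simps:
  "cblinfun_apply (f + g) x = cblinfun_apply f x + cblinfun_apply g x"
  "cblinfun_apply (r *\<^sub>R f) x = r *\<^sub>R cblinfun_apply f x"
  "cblinfun_apply (c *\<^sub>C f) x = c *\<^sub>C cblinfun_apply f x"
  by (transfer, simp add: blinfun.add_left blinfun.scaleR_left blinfun_scaleC)+

lemma norm_cblinfun: "norm (cblinfun_apply f x) \<le> norm f * norm x"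
  by transfer (rule norm_blinfun)

lemma norm_cblinfun_bound:
  "0 \<le> c \<Longrightarrow> (\<And>x. norm (cblinfun_apply f x) \<le> c * norm x) \<Longrightarrow> norm f \<le> c"
  by transfer (rule norm_blinfun_bound)

lemma norm_cblinfun_bound_unit:
  "(\<And>x. norm x \<le> 1 \<Longrightarrow> norm (cblinfun_apply f x) \<le> c) \<Longrightarrow> norm f \<le> c"
  by transfer (rule norm_blinfun_bound_unit)

lemma cblinfun_compose_apply: "cblinfun_apply (f o\<^sub>C\<^sub>L g) x = cblinfun_apply f (cblinfun_apply g x)"
  by transfer simp

lemma cblinfun_apply_CBlinfun_Blinfun:
  assumes "bounded_linear F" and "\<And>c x. F (c *\<^sub>C x) = c *\<^sub>C F x"
  shows "cblinfun_apply (CBlinfun (Blinfun F)) = F"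
  using assms by (simp add: cblinfun_apply.rep_eq CBlinfun_inverse bounded_linear_Blinfun_apply)

lemma scaleC_Complex: "c *\<^sub>C x = Re c *\<^sub>R x + Im c *\<^sub>R \<i> *\<^sub>C (x :: 'a::complex_normed_vector)"
proof -
  have "c *\<^sub>C x = (complex_of_real (Re c) + complex_of_real (Im c) * \<i>) *\<^sub>C x"
    using complex_eq[of c] by (simp add: mult.commute)
  then show ?thesis by (simp add: scaleC_add_left scaleR_scaleC scaleC_scaleC)
qed

lemma scaleC_minus_one: "(- 1) *\<^sub>C x = - (x :: 'a::complex_normed_vector)"
  using scaleR_scaleC[of "- 1" x] by simp

lemma scaleC_commutes_if_i:
  fixes F :: "'a::complex_normed_vector \<Rightarrow> 'b::complex_normed_vector"
  assumes "linear F" and "\<And>x. F (\<i> *\<^sub>C x) = \<i> *\<^sub>C F x"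
  shows "F (c *\<^sub>C x) = c *\<^sub>C F x"
  by (simp add: scaleC_Complex[of c] linear_add[OF assms(1)] linear_scale[OF assms(1)] assms(2))

section \<open>Real parts and complexification of functionals\<close>

definition re_part :: "'a::complex_normed_vector cdual \<Rightarrow> 'a dual"
  where "re_part y = Blinfun (\<lambda>x. Re (cblinfun_apply y x))"

text \<open>The formula f x - \<i> f (\<i> x) gives the unique complex-linear functional with real
  part \<open>f\<close>.\<close>

definition complexify :: "'a::complex_normed_vector dual \<Rightarrow> 'a cdual"
  where "complexify f = CBlinfun (Blinfun (\<lambda>x. Complex (f x) (- f (\<i> *\<^sub>C x))))"

lemma re_part_apply: "re_part y x = Re (cblinfun_apply y x)"
  unfolding re_part_def
  by (simp add: bounded_linear_Blinfun_apply bounded_linear_compose[OF bounded_linear_Re bounded_linear_cblinfun])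

lemma complexify_apply: "cblinfun_apply (complexify f) x = Complex (f x) (- f (\<i> *\<^sub>C x))"
proof -
  let ?F = "\<lambda>x. complex_of_real (f x) - \<i> * complex_of_real (f (\<i> *\<^sub>C x))"
  have F: "(\<lambda>x. Complex (f x) (- f (\<i> *\<^sub>C x))) = ?F"
    by (auto simp: complex_eq_iff)
  have bl: "bounded_linear ?F"
    by (intro bounded_linear_sub bounded_linear_const_mult bounded_linear_compose[OF bounded_linear_of_real]
        bounded_linear_compose[OF blinfun.bounded_linear_right bounded_linear_scaleC] blinfun.bounded_linear_right)
  have "?F (\<i> *\<^sub>C x) = \<i> *\<^sub>C ?F x" for x
    by (simp add: scaleC_scaleC scaleC_minus_one scaleC_complex_def blinfun.minus_right complex_eq_iff)
  then have "?F (c *\<^sub>C x) = c *\<^sub>C ?F x" for c x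
    by (rule scaleC_commutes_if_i[OF bounded_linear.linear[OF bl]])
  from cblinfun_apply_CBlinfun_Blinfun[OF bl this] show ?thesis
    unfolding complexify_def F by (simp add: complex_eq_iff)
qed

lemma complexify_re_part: "complexify (re_part y) = y"
  by (rule cblinfun_eqI)
    (simp add: complexify_apply re_part_apply cblinfun_scaleC_right scaleC_complex_def complex_eq_iff)

lemma norm_re_part: "norm (re_part y) \<le> norm y"
  by (rule norm_blinfun_bound)
    (simp_all add: re_part_apply order_trans[OF abs_Re_le_cmod norm_cblinfun])

text \<open>Rotating x by a unimodular scalar makes the value real and nonnegative; there it
  coincides with \<open>f\<close> at a vector of the same norm.\<close>

lemma norm_complexify: "norm (complexify f) \<le> norm f"
proof (rule norm_cblinfun_bound)
  fix x
  define w where "w = cblinfun_apply (complexify f) x"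
  show "norm w \<le> norm f * norm x"
  proof (cases "w = 0")
    case False
    define c where "c = cnj w / complex_of_real (norm w)"
    have c: "norm c = 1" using False by (simp add: c_def norm_divide)
    have "c * w = complex_of_real (norm w)"
      using False by (simp add: c_def complex_norm_square[symmetric] mult.commute power2_eq_square)
    then have "norm w = Re (cblinfun_apply (complexify f) (c *\<^sub>C x))"
      by (simp add: cblinfun_scaleC_right scaleC_complex_def w_def)
    also have "\<dots> = f (c *\<^sub>C x)" by (simp add: complexify_apply)
    also have "\<dots> \<le> norm f * norm (c *\<^sub>C x)" using norm_blinfun[of f "c *\<^sub>C x"] by simp
    finally show ?thesis by (simp add: norm_scaleC c)
  qed simp
qed simp

lemma bounded_linear_re_part: "bounded_linear re_part"
proof (rule bounded_linear_intro[where K = 1])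
  show "re_part (x + y) = re_part x + re_part y" for x y :: "'a cdual"
    by (rule blinfun_eqI) (simp add: re_part_apply blinfun.add_left cblinfun_left_simps complex_eq_iff)
  show "re_part (r *\<^sub>R x) = r *\<^sub>R re_part x" for r and x :: "'a cdual"
    by (rule blinfun_eqI) (simp add: re_part_apply blinfun.scaleR_left cblinfun_left_simps complex_eq_iff)
qed (simp add: norm_re_part)

lemma bounded_linear_complexify: "bounded_linear complexify"
proof (rule bounded_linear_intro[where K = 1])
  show "complexify (x + y) = complexify x + complexify y" for x y :: "'a dual"
    by (rule cblinfun_eqI) (simp add: complexify_apply blinfun.add_left cblinfun_left_simps complex_eq_iff)
  show "complexify (r *\<^sub>R x) = r *\<^sub>R complexify x" for r and x :: "'a dual"
    by (rule cblinfun_eqI) (simp add: complexify_apply blinfun.scaleR_left cblinfun_left_simps complex_eq_iff)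
qed (simp add: norm_complexify)

text \<open>
  Mutually inverse real-linear isometries between the complex bidual and the bidual of the
  underlying real space.
\<close>

definition bidual_re :: "'a::complex_normed_vector cbidual \<Rightarrow> 'a bidual"
  where "bidual_re z = re_part z o\<^sub>L Blinfun complexify"

definition bidual_complexify :: "'a::complex_normed_vector bidual \<Rightarrow> 'a cbidual"
  where "bidual_complexify w = complexify (w o\<^sub>L Blinfun re_part)"

lemma bidual_re_apply: "bidual_re z f = Re (cblinfun_apply z (complexify f))"
  by (simp add: bidual_re_def re_part_apply bounded_linear_Blinfun_apply[OF bounded_linear_complexify])

lemma bidual_complexify_apply:
  "cblinfun_apply (bidual_complexify w) y = Complex (w (re_part y)) (- w (re_part (\<i> *\<^sub>C y)))"
  by (simp add: bidual_complexify_def complexify_apply bounded_linear_Blinfun_apply[OF bounded_linear_re_part])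

lemma bidual_complexify_re: "bidual_complexify (bidual_re z) = z"
  by (rule cblinfun_eqI)
    (simp add: bidual_complexify_apply bidual_re_apply complexify_re_part cblinfun_scaleC_right
      scaleC_complex_def complex_eq_iff)

lemma norm_Blinfun_le_1:
  assumes "bounded_linear F" and "\<And>x. norm (F x) \<le> norm x"
  shows "norm (Blinfun F) \<le> 1"
  by (rule norm_blinfun_bound) (use assms in \<open>auto simp: bounded_linear_Blinfun_apply\<close>)

lemma norm_bidual_re: "norm (bidual_re z) \<le> norm z"
proof -
  have "norm (bidual_re z) \<le> norm (re_part z) * norm (Blinfun complexify :: 'a dual \<Rightarrow>\<^sub>L 'a cdual)"
    unfolding bidual_re_def by (rule norm_blinfun_compose)
  also have "\<dots> \<le> norm z * 1"
    by (intro mult_mono norm_re_part norm_Blinfun_le_1 bounded_linear_complexify norm_complexify) auto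
  finally show ?thesis by simp
qed

lemma norm_bidual_complexify: "norm (bidual_complexify w) \<le> norm w"
proof -
  have "norm (bidual_complexify w) \<le> norm (w o\<^sub>L (Blinfun re_part :: 'a cdual \<Rightarrow>\<^sub>L 'a dual))"
    unfolding bidual_complexify_def by (rule norm_complexify)
  also have "\<dots> \<le> norm w * norm (Blinfun re_part :: 'a cdual \<Rightarrow>\<^sub>L 'a dual)"
    by (rule norm_blinfun_compose)
  also have "\<dots> \<le> norm w * 1"
    by (intro mult_mono norm_Blinfun_le_1 bounded_linear_re_part norm_re_part) auto
  finally show ?thesis by simp
qed

lemma bounded_linear_bidual_re: "bounded_linear bidual_re"
proof (rule bounded_linear_intro[where K = 1])
  show "bidual_re (x + y) = bidual_re x + bidual_re y" for x y :: "'a cbidual"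
    by (rule blinfun_eqI) (simp add: bidual_re_apply blinfun.add_left cblinfun_left_simps complex_eq_iff)
  show "bidual_re (r *\<^sub>R x) = r *\<^sub>R bidual_re x" for r and x :: "'a cbidual"
    by (rule blinfun_eqI) (simp add: bidual_re_apply blinfun.scaleR_left cblinfun_left_simps complex_eq_iff)
qed (simp add: norm_bidual_re)

lemma bounded_linear_bidual_complexify: "bounded_linear bidual_complexify"
proof (rule bounded_linear_intro[where K = 1])
  show "bidual_complexify (x + y) = bidual_complexify x + bidual_complexify y" for x y :: "'a bidual"
    by (rule cblinfun_eqI) (simp add: bidual_complexify_apply blinfun.add_left cblinfun_left_simps complex_eq_iff)
  show "bidual_complexify (r *\<^sub>R x) = r *\<^sub>R bidual_complexify x" for r and x :: "'a bidual"
    by (rule cblinfun_eqI) (simp add: bidual_complexify_apply blinfun.scaleR_left cblinfun_left_simps complex_eq_iff)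
qed (simp add: norm_bidual_complexify)

section \<open>Complex subspaces, spans and annihilators seen over the reals\<close>

lemma linear_scaleC: "linear (\<lambda>x. c *\<^sub>C (x :: 'a::complex_normed_vector))"
  by (rule bounded_linear.linear[OF bounded_linear_scaleC])

lemma subspace_scaleC_iff:
  "module.subspace scaleC (U :: 'a::complex_normed_vector set) \<longleftrightarrow> subspace U \<and> (\<forall>x\<in>U. \<i> *\<^sub>C x \<in> U)"
proof -
  interpret cv: vector_space "scaleC :: complex \<Rightarrow> 'a \<Rightarrow> 'a" by (rule vector_space_scaleC)
  show ?thesis
  proof
    assume "cv.subspace U"
    then show "subspace U \<and> (\<forall>x\<in>U. \<i> *\<^sub>C x \<in> U)"
      by (auto simp: cv.subspace_def subspace_def scaleR_scaleC)
  next
    assume U: "subspace U \<and> (\<forall>x\<in>U. \<i> *\<^sub>C x \<in> U)"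
    then have "c *\<^sub>C x \<in> U" if "x \<in> U" for c x
      unfolding scaleC_Complex[of c x] using that by (intro subspace_add subspace_scale) auto
    then show "cv.subspace U"
      using U by (auto simp: cv.subspace_def subspace_def)
  qed
qed

text \<open>The real span of \<open>B\<close> and \<i> B is stable under \<i>, as \<i> squared is
  -1, and is therefore a complex subspace. Doubling a finite spanning set thus transfers finite rank
  from \<open>S\<close> to its real form.\<close>

lemma cspan_subset_span:
  "module.span scaleC (B :: 'a::complex_normed_vector set) \<subseteq> span (B \<union> scaleC \<i> ` B)"
proof -
  interpret cv: vector_space "scaleC :: complex \<Rightarrow> 'a \<Rightarrow> 'a" by (rule vector_space_scaleC)
  let ?V = "span (B \<union> scaleC \<i> ` B)"
  have "scaleC \<i> ` (B \<union> scaleC \<i> ` B) \<subseteq> ?V"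
    by (auto simp: scaleC_scaleC scaleC_minus_one span_base span_neg)
  then have "span (scaleC \<i> ` (B \<union> scaleC \<i> ` B)) \<subseteq> ?V" by (rule span_minimal) (rule subspace_span)
  then have "scaleC \<i> ` ?V \<subseteq> ?V" by (simp only: linear_span_image[OF linear_scaleC])
  then have "cv.subspace ?V" unfolding subspace_scaleC_iff by (auto intro: subspace_span)
  then show ?thesis by (intro cv.span_minimal) (auto intro: span_base)
qed

lemma span_subset_cspan: "span (B :: 'a::complex_normed_vector set) \<subseteq> module.span scaleC B"
proof -
  interpret cv: vector_space "scaleC :: complex \<Rightarrow> 'a \<Rightarrow> 'a" by (rule vector_space_scaleC)
  have "subspace (cv.span B)" using cv.subspace_span[of B] by (simp add: subspace_scaleC_iff)
  then show ?thesis by (intro span_minimal) (auto intro: cv.span_base)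
qed

lemma re_part_in_annihilator:
  "y \<in> annihilator cblinfun_apply U \<Longrightarrow> re_part y \<in> annihilator blinfun_apply U"
  by (simp add: annihilator_def re_part_apply)

text \<open>The imaginary part evaluates \<open>f\<close> at \<i> x, so stability of
  \<open>U\<close> under \<i> enters.\<close>

lemma complexify_in_annihilator:
  assumes "\<And>x. x \<in> U \<Longrightarrow> \<i> *\<^sub>C x \<in> U" and "f \<in> annihilator blinfun_apply U"
  shows "complexify f \<in> annihilator cblinfun_apply U"
  using assms by (simp add: annihilator_def complexify_apply complex_eq_iff)

lemma bidual_re_in_biannihilator:
  assumes "\<And>x. x \<in> U \<Longrightarrow> \<i> *\<^sub>C x \<in> U" and "z \<in> cbiannihilator U"
  shows "bidual_re z \<in> biannihilator U"
  using complexify_in_annihilator[of U, OF assms(1)] assms(2)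
  by (simp add: annihilator_def[of _ "annihilator _ _"] bidual_re_apply)

text \<open>The imaginary part at y is read off at \<i> y, and the annihilator in the complex dual
  is stable under \<i>.\<close>

lemma bidual_complexify_in_biannihilator:
  assumes "w \<in> biannihilator U"
  shows "bidual_complexify w \<in> cbiannihilator U"
proof -
  have "cblinfun_apply (bidual_complexify w) y = 0" if y: "y \<in> annihilator cblinfun_apply U" for y
  proof -
    have "\<i> *\<^sub>C y \<in> annihilator cblinfun_apply U"
      using y by (simp add: annihilator_def cblinfun_left_simps scaleC_complex_def)
    then have "w (re_part y) = 0" "w (re_part (\<i> *\<^sub>C y)) = 0"
      using assms y re_part_in_annihilator by (auto simp: annihilator_def[of _ "annihilator _ _"])
    then show ?thesis by (simp add: bidual_complexify_apply complex_eq_iff)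
  qed
  then show ?thesis by (simp add: annihilator_def[of _ "annihilator _ _"])
qed

text \<open>
  A real-linear approximant \<open>T\<close> of the underlying real operator is averaged to the complex-linear
  operator \<open>(T - \<i> T \<i>) / 2\<close>, which has no larger norm and preserves the same complex subspaces.
\<close>

theorem nest_local_reflexivity_compact_complex:
  fixes Q :: "nat \<Rightarrow> 'a::complex_normed_vector set" and S :: "'a cbidual \<Rightarrow>\<^sub>C\<^sub>L 'a cbidual"
  assumes Q: "\<And>n. module.subspace scaleC (Q n)" "\<And>n. Q n \<subseteq> Q (Suc n)"
    and fin: "finite_rank scaleC (cblinfun_apply S)"
    and inv: "\<And>U. U \<in> scheme_nest Q \<Longrightarrow> cblinfun_apply S ` cbiannihilator U \<subseteq> cbiannihilator U"
    and K: "compact K" and L: "compact L" and \<epsilon>: "\<epsilon> > 0"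
  shows "\<exists>T :: 'a \<Rightarrow>\<^sub>C\<^sub>L 'a. finite_rank scaleC (cblinfun_apply T) \<and>
    (\<forall>U\<in>scheme_nest Q. cblinfun_apply T ` U \<subseteq> U) \<and> norm T < norm S + \<epsilon> \<and>
    (\<forall>z\<in>K. \<forall>y\<in>L. norm (cblinfun_apply z (cadjoint_op T y) - cblinfun_apply (cblinfun_apply S z) y) < \<epsilon>)"
proof -
  have iQ: "\<i> *\<^sub>C x \<in> Q n" if "x \<in> Q n" for x n
    using Q(1)[of n] that by (simp add: subspace_scaleC_iff)
  have i_nest: "\<i> *\<^sub>C x \<in> U" if U: "U \<in> scheme_nest Q" and x: "x \<in> U" for U x
  proof -
    consider n where "U = Q n" | "U = scheme_limit Q" | "U = UNIV" using U by (auto simp: scheme_nest_def)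
    then show ?thesis
    proof cases
      case 2
      have "scaleC \<i> ` (\<Union>n. Q n) \<subseteq> (\<Union>n. Q n)" using iQ by auto
      then have "scaleC \<i> ` closure (\<Union>n. Q n) \<subseteq> closure (\<Union>n. Q n)"
        by (intro order_trans[OF closure_bounded_linear_image_subset[OF bounded_linear_scaleC] closure_mono])
      then show ?thesis using x 2 by (auto simp: scheme_limit_def)
    qed (use x iQ in auto)
  qed

  define S' where "S' = Blinfun (\<lambda>w. bidual_re (cblinfun_apply S (bidual_complexify w)))"
  have "bounded_linear (\<lambda>w. bidual_re (cblinfun_apply S (bidual_complexify w)))"
    by (intro bounded_linear_compose[OF bounded_linear_bidual_re]
        bounded_linear_compose[OF bounded_linear_cblinfun] bounded_linear_bidual_complexify)
  then have S': "S' w = bidual_re (cblinfun_apply S (bidual_complexify w))" for w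
    by (simp add: S'_def bounded_linear_Blinfun_apply)
  have "norm (S' w) \<le> norm S * norm w" for w
  proof -
    have "norm (S' w) \<le> norm (cblinfun_apply S (bidual_complexify w))" unfolding S' by (rule norm_bidual_re)
    also have "\<dots> \<le> norm S * norm (bidual_complexify w)" by (rule norm_cblinfun)
    also have "\<dots> \<le> norm S * norm w" by (intro mult_left_mono norm_bidual_complexify) simp
    finally show ?thesis .
  qed
  then have S'_le: "norm S' \<le> norm S" by (rule norm_blinfun_bound[OF norm_ge_zero])
  have finS': "finite_rank scaleR (blinfun_apply S')"
  proof -
    obtain B where B: "finite B" "range (cblinfun_apply S) \<subseteq> module.span scaleC B"
      using fin by (auto simp: finite_rank_def)
    have "S' w \<in> span (bidual_re ` (B \<union> scaleC \<i> ` B))" for w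
    proof -
      have "cblinfun_apply S (bidual_complexify w) \<in> span (B \<union> scaleC \<i> ` B)"
        using B(2) cspan_subset_span by blast
      then show ?thesis
        unfolding S' linear_span_image[OF bounded_linear.linear[OF bounded_linear_bidual_re]] by (rule imageI)
    qed
    then show ?thesis
      unfolding finite_rank_def span_raw_def[symmetric] using B(1)
      by (intro exI[of _ "bidual_re ` (B \<union> scaleC \<i> ` B)"]) auto
  qed
  have invS': "S' ` biannihilator U \<subseteq> biannihilator U" if U: "U \<in> scheme_nest Q" for U
  proof (intro image_subsetI)
    fix w assume "w \<in> biannihilator U"
    then have "cblinfun_apply S (bidual_complexify w) \<in> cbiannihilator U"
      using inv[OF U] bidual_complexify_in_biannihilator by blast
    then show "S' w \<in> biannihilator U"
      unfolding S' by (intro bidual_re_in_biannihilator i_nest[OF U])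
  qed

  \<comment> \<open>Two enlargements by rotation. Adding - \<i> times \<open>L\<close> recovers
    imaginary parts, as Im w = Re (- \<i> w). The further rotations in \<open>K'\<close> and
    \<open>L'\<close> are needed because the averaged operator is tested at the pairs (z, y) and
    (\<i> z, - \<i> y).\<close>
  define L1 where "L1 = L \<union> scaleC (- \<i>) ` L"
  define K' where "K' = bidual_re ` (K \<union> scaleC \<i> ` K)"
  define L' where "L' = re_part ` (L1 \<union> scaleC (- \<i>) ` L1)"
  have cont: "continuous_on A F" if "bounded_linear F" for A and F :: "'x::real_normed_vector \<Rightarrow> 'y::real_normed_vector"
    using that by (rule bounded_linear.continuous_on) (rule continuous_on_id)
  have compactL1: "compact L1"
    unfolding L1_def by (intro compact_Un compact_continuous_image cont bounded_linear_scaleC L)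
  have compactK': "compact K'"
    unfolding K'_def
    by (intro compact_Un compact_continuous_image cont bounded_linear_scaleC bounded_linear_bidual_re K)
  have compactL': "compact L'"
    unfolding L'_def
    by (intro compact_Un compact_continuous_image cont bounded_linear_scaleC bounded_linear_re_part compactL1)
  have subQ: "subspace (Q n)" for n using Q(1)[of n] by (simp add: subspace_scaleC_iff)
  have "\<epsilon> / 2 > 0" using \<epsilon> by simp
  with nest_local_reflexivity_compact[where Q = Q and S = S', OF subQ Q(2) finS' invS' compactK' compactL']
  obtain T where T: "finite_rank scaleR (blinfun_apply T)"
    "\<forall>U\<in>scheme_nest Q. blinfun_apply T ` U \<subseteq> U" "norm T < norm S' + \<epsilon> / 2"
    "\<forall>z\<in>K'. \<forall>y\<in>L'. \<bar>blinfun_apply z (adjoint_op T y) - blinfun_apply (blinfun_apply S' z) y\<bar> < \<epsilon> / 2"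
    by blast

  define F where "F v = (1 / 2) *\<^sub>R (T v - \<i> *\<^sub>C T (\<i> *\<^sub>C v))" for v
  have blF: "bounded_linear F"
    unfolding F_def
    by (intro bounded_linear_compose[OF bounded_linear_scaleR_right] bounded_linear_sub
        bounded_linear_compose[OF bounded_linear_scaleC]
        bounded_linear_compose[OF blinfun.bounded_linear_right bounded_linear_scaleC] blinfun.bounded_linear_right)
  have "F (\<i> *\<^sub>C v) = \<i> *\<^sub>C F v" for v
    by (simp add: F_def scaleC_scaleC scaleC_minus_one blinfun.minus_right scaleC_minus_right
        linear_scale[OF linear_scaleC] linear_diff[OF linear_scaleC] add.commute)
  then have "F (c *\<^sub>C v) = c *\<^sub>C F v" for c v
    by (rule scaleC_commutes_if_i[OF bounded_linear.linear[OF blF]])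
  then have ex: "cblinfun_apply (CBlinfun (Blinfun F)) = F"
    by (rule cblinfun_apply_CBlinfun_Blinfun[OF blF])
  define T' where "T' = CBlinfun (Blinfun F)"
  have T': "cblinfun_apply T' v = F v" for v by (simp add: T'_def ex)
  note nest_sub = subspace_nest(2)[of Q, OF subQ Q(2)]
  \<comment> \<open>The real part of the pairing with the averaged operator is the mean of two real
    pairings with \<open>T\<close>, at (z, y) and at (\<i> z, - \<i> y). Complex linearity of
    \<open>S\<close> gives both targets the same value, since \<i> times - \<i> is 1, so the mean of
    two good approximations is again good.\<close>
  have real_part: "\<bar>Re (cblinfun_apply z (cadjoint_op T' y) - cblinfun_apply (cblinfun_apply S z) y)\<bar> < \<epsilon> / 2"
    if z: "z \<in> K" and y: "y \<in> L1" for z y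
  proof -
    let ?a = "adjoint_op T (re_part y)" and ?b = "adjoint_op T (re_part ((- \<i>) *\<^sub>C y))"
    have "cadjoint_op T' y = (1 / 2) *\<^sub>R (complexify ?a + \<i> *\<^sub>C complexify ?b)"
      by (rule cblinfun_eqI)
        (simp add: cadjoint_op_def cblinfun_compose_apply T' F_def cblinfun_left_simps cblinfun_right_simps
          cblinfun_scaleC_right complexify_apply adjoint_op_def re_part_apply scaleC_complex_def complex_eq_iff)
    then have split: "Re (cblinfun_apply z (cadjoint_op T' y)) =
        (bidual_re z ?a + bidual_re (\<i> *\<^sub>C z) ?b) / 2"
      by (simp add: cblinfun_right_simps cblinfun_left_simps cblinfun_scaleC_right bidual_re_apply scaleC_complex_def)
    have S1: "S' (bidual_re z) (re_part y) = Re (cblinfun_apply (cblinfun_apply S z) y)"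
      by (simp add: S' bidual_complexify_re bidual_re_apply complexify_re_part)
    have S2: "S' (bidual_re (\<i> *\<^sub>C z)) (re_part ((- \<i>) *\<^sub>C y)) = Re (cblinfun_apply (cblinfun_apply S z) y)"
      by (simp add: S' bidual_complexify_re bidual_re_apply complexify_re_part cblinfun_scaleC_right
          cblinfun_left_simps scaleC_complex_def)
    have "\<bar>bidual_re z ?a - S' (bidual_re z) (re_part y)\<bar> < \<epsilon> / 2"
      using z y by (intro T(4)[rule_format]) (auto simp: K'_def L'_def)
    moreover have "\<bar>bidual_re (\<i> *\<^sub>C z) ?b - S' (bidual_re (\<i> *\<^sub>C z)) (re_part ((- \<i>) *\<^sub>C y))\<bar> < \<epsilon> / 2"
      using z y by (intro T(4)[rule_format]) (auto simp: K'_def L'_def)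
    ultimately show ?thesis
      unfolding S1 S2 minus_complex.sel split abs_less_iff by (simp add: field_simps)
  qed
  show ?thesis
  proof (intro exI[of _ T'] conjI ballI)
    obtain B where B: "finite B" "range (blinfun_apply T) \<subseteq> span B"
      using T(1) by (auto simp: finite_rank_def span_raw_def)
    interpret cv: vector_space "scaleC :: complex \<Rightarrow> 'a \<Rightarrow> 'a" by (rule vector_space_scaleC)
    have "T v \<in> cv.span B" for v using B(2) span_subset_cspan by blast
    then have "cblinfun_apply T' v \<in> cv.span B" for v
      unfolding T' F_def scaleR_scaleC by (intro cv.span_scale cv.span_diff)
    then show "finite_rank scaleC (cblinfun_apply T')"
      unfolding finite_rank_def using B(1) by blast
    show "cblinfun_apply T' ` U \<subseteq> U" if U: "U \<in> scheme_nest Q" for U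
    proof (intro image_subsetI)
      fix v assume v: "v \<in> U"
      have TU: "T u \<in> U" if "u \<in> U" for u using T(2) U that by blast
      show "cblinfun_apply T' v \<in> U"
        unfolding T' F_def using nest_sub[OF U] i_nest[OF U] TU v
        by (intro subspace_scale subspace_diff) auto
    qed
    have "norm T' \<le> norm T"
    proof (rule norm_cblinfun_bound)
      fix v
      have "norm (cblinfun_apply T' v) \<le> (norm (T v) + norm (T (\<i> *\<^sub>C v))) / 2"
        using norm_triangle_ineq4[of "T v" "\<i> *\<^sub>C T (\<i> *\<^sub>C v)"] by (simp add: T' F_def norm_scaleC)
      also have "\<dots> \<le> norm T * norm v"
        using norm_blinfun[of T v] norm_blinfun[of T "\<i> *\<^sub>C v"] by (simp add: norm_scaleC)
      finally show "norm (cblinfun_apply T' v) \<le> norm T * norm v" .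
    qed simp
    then show "norm T' < norm S + \<epsilon>" using T(3) S'_le \<epsilon> by linarith
    fix z y assume z: "z \<in> K" and y: "y \<in> L"
    let ?w = "cblinfun_apply z (cadjoint_op T' y) - cblinfun_apply (cblinfun_apply S z) y"
    have "cadjoint_op T' ((- \<i>) *\<^sub>C y) = (- \<i>) *\<^sub>C cadjoint_op T' y"
      by (rule cblinfun_eqI) (simp add: cadjoint_op_def cblinfun_compose_apply cblinfun_left_simps)
    then have "Im ?w = Re (cblinfun_apply z (cadjoint_op T' ((- \<i>) *\<^sub>C y)) -
        cblinfun_apply (cblinfun_apply S z) ((- \<i>) *\<^sub>C y))"
      by (simp add: cblinfun_scaleC_right scaleC_complex_def)
    then have "\<bar>Im ?w\<bar> < \<epsilon> / 2" using real_part[OF z, of "(- \<i>) *\<^sub>C y"] y by (simp add: L1_def)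
    moreover have "\<bar>Re ?w\<bar> < \<epsilon> / 2" using real_part[OF z, of y] y by (simp add: L1_def)
    ultimately show "norm ?w < \<epsilon>" using cmod_le[of ?w] by linarith
  qed
qed

section \<open>Norm witnesses and the two-sided norm estimate\<close>

lemma bidual_operator_norm_witness:
  fixes S :: "'a::real_normed_vector bidual \<Rightarrow>\<^sub>L 'a bidual"
  assumes "\<epsilon> > 0"
  shows "\<exists>z y. norm z \<le> 1 \<and> norm y \<le> 1 \<and> norm S - \<epsilon> < \<bar>blinfun_apply (blinfun_apply S z) y\<bar>"
proof (rule ccontr)
  assume "\<not> ?thesis"
  then have "norm (S z y) \<le> norm S - \<epsilon>" if "norm z \<le> 1" "norm y \<le> 1" for z y
    using that by (simp add: not_less)
  then have "norm S \<le> norm S - \<epsilon>" by (intro norm_blinfun_bound_unit)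
  with assms show False by simp
qed

lemma cbidual_operator_norm_witness:
  fixes S :: "'a::complex_normed_vector cbidual \<Rightarrow>\<^sub>C\<^sub>L 'a cbidual"
  assumes "\<epsilon> > 0"
  shows "\<exists>z y. norm z \<le> 1 \<and> norm y \<le> 1 \<and> norm S - \<epsilon> < norm (cblinfun_apply (cblinfun_apply S z) y)"
proof (rule ccontr)
  assume "\<not> ?thesis"
  then have "norm (cblinfun_apply (cblinfun_apply S z) y) \<le> norm S - \<epsilon>" if "norm z \<le> 1" "norm y \<le> 1" for z y
    using that by (simp add: not_less)
  then have "norm S \<le> norm S - \<epsilon>" by (intro norm_cblinfun_bound_unit)
  with assms show False by simp
qed

lemma cadjoint_pairing_le:
  fixes T :: "'a::complex_normed_vector \<Rightarrow>\<^sub>C\<^sub>L 'a"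
  shows "norm (cblinfun_apply z (cadjoint_op T y)) \<le> norm T * norm z * norm y"
proof -
  have "norm (cadjoint_op T y) \<le> norm y * norm T"
    unfolding cadjoint_op_def by transfer (rule norm_blinfun_compose)
  then have "norm z * norm (cadjoint_op T y) \<le> norm z * (norm y * norm T)" by (rule mult_left_mono) simp
  with norm_cblinfun[of z "cadjoint_op T y"] show ?thesis by (simp add: mult_ac)
qed

lemma mult_le_of_le_1: "t * a * b \<le> t" if "0 \<le> t" "0 \<le> a" "a \<le> 1" "0 \<le> b" "b \<le> (1::real)"
  using mult_mono[of a 1 b 1] mult_left_mono[of "a * b" 1 t] that by (simp add: mult.assoc)

theorem nest_local_reflexivity:
  fixes Q :: "nat \<Rightarrow> 'a::real_normed_vector set" and S :: "'a bidual \<Rightarrow>\<^sub>L 'a bidual"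
  assumes Q: "ga_scheme scaleR Q"
    and fin: "finite_rank scaleR (blinfun_apply S)"
    and inv: "\<forall>U\<in>scheme_nest Q. blinfun_apply S ` biannihilator U \<subseteq> biannihilator U"
    and K: "compact K" and L: "compact L" and \<epsilon>: "\<epsilon> > 0"
  shows "\<exists>T :: 'a \<Rightarrow>\<^sub>L 'a. finite_rank scaleR (blinfun_apply T) \<and>
    (\<forall>U\<in>scheme_nest Q. blinfun_apply T ` U \<subseteq> U) \<and> \<bar>norm T - norm S\<bar> < \<epsilon> \<and>
    (\<forall>x\<in>K. \<forall>y\<in>L. \<bar>blinfun_apply x (adjoint_op T y) - blinfun_apply (blinfun_apply S x) y\<bar> < \<epsilon>)"
proof -
  have Q': "subspace (Q n)" "Q n \<subseteq> Q (Suc n)" for n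
    using Q by (auto simp: ga_scheme_def subspace_raw_def)
  have inv': "blinfun_apply S ` biannihilator U \<subseteq> biannihilator U" if "U \<in> scheme_nest Q" for U
    using inv that by blast
  have \<epsilon>2: "\<epsilon> / 2 > 0" using \<epsilon> by simp
  \<comment> \<open>An almost norming pair is added to the test sets. Its pairing with the adjoint
    of \<open>T\<close> is at most norm T and within \<epsilon>/2 of S z0 y0, which forces norm T >
    norm S - \<epsilon>; closeness on the test sets thus controls the norm from below.\<close>
  obtain z0 y0 where zy: "norm z0 \<le> 1" "norm y0 \<le> 1" "norm S - \<epsilon> / 2 < \<bar>S z0 y0\<bar>"
    using bidual_operator_norm_witness[OF \<epsilon>2, of S] by blast
  have cK: "compact (insert z0 K)" and cL: "compact (insert y0 L)" using K L by (auto intro: compact_insert)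
  from nest_local_reflexivity_compact[where Q = Q and S = S, OF Q' fin inv' cK cL \<epsilon>2]
  obtain T :: "'a \<Rightarrow>\<^sub>L 'a" where T: "finite_rank scaleR (blinfun_apply T)"
    "\<forall>U\<in>scheme_nest Q. blinfun_apply T ` U \<subseteq> U" "norm T < norm S + \<epsilon> / 2"
    "\<forall>z\<in>insert z0 K. \<forall>y\<in>insert y0 L.
      \<bar>blinfun_apply z (adjoint_op T y) - blinfun_apply (blinfun_apply S z) y\<bar> < \<epsilon> / 2"
    by blast
  have "\<bar>z0 (adjoint_op T y0)\<bar> \<le> norm T"
    using adjoint_pairing_le[of z0 T y0] mult_le_of_le_1[of "norm T" "norm z0" "norm y0"] zy by simp
  moreover have "\<bar>z0 (adjoint_op T y0) - S z0 y0\<bar> < \<epsilon> / 2" using T(4) by simp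
  ultimately have "\<bar>norm T - norm S\<bar> < \<epsilon>" using zy(3) T(3) by linarith
  moreover have "\<bar>z (adjoint_op T y) - S z y\<bar> < \<epsilon>" if "z \<in> K" "y \<in> L" for z y
  proof -
    have "\<bar>z (adjoint_op T y) - S z y\<bar> < \<epsilon> / 2" using T(4) that by simp
    then show ?thesis using \<epsilon> by linarith
  qed
  ultimately show ?thesis using T(1,2) by blast
qed

theorem nest_local_reflexivity_complex:
  fixes Q :: "nat \<Rightarrow> 'a::complex_normed_vector set" and S :: "'a cbidual \<Rightarrow>\<^sub>C\<^sub>L 'a cbidual"
  assumes Q: "ga_scheme scaleC Q"
    and fin: "finite_rank scaleC (cblinfun_apply S)"
    and inv: "\<forall>U\<in>scheme_nest Q. cblinfun_apply S ` cbiannihilator U \<subseteq> cbiannihilator U"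
    and K: "compact K" and L: "compact L" and \<epsilon>: "\<epsilon> > 0"
  shows "\<exists>T :: 'a \<Rightarrow>\<^sub>C\<^sub>L 'a. finite_rank scaleC (cblinfun_apply T) \<and>
    (\<forall>U\<in>scheme_nest Q. cblinfun_apply T ` U \<subseteq> U) \<and> \<bar>norm T - norm S\<bar> < \<epsilon> \<and>
    (\<forall>x\<in>K. \<forall>y\<in>L. norm (cblinfun_apply x (cadjoint_op T y) - cblinfun_apply (cblinfun_apply S x) y) < \<epsilon>)"
proof -
  have Q': "module.subspace scaleC (Q n)" "Q n \<subseteq> Q (Suc n)" for n
    using Q by (auto simp: ga_scheme_def)
  have inv': "cblinfun_apply S ` cbiannihilator U \<subseteq> cbiannihilator U" if "U \<in> scheme_nest Q" for U
    using inv that by blast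
  have \<epsilon>2: "\<epsilon> / 2 > 0" using \<epsilon> by simp
  obtain z0 y0 where zy: "norm z0 \<le> 1" "norm y0 \<le> 1"
    "norm S - \<epsilon> / 2 < norm (cblinfun_apply (cblinfun_apply S z0) y0)"
    using cbidual_operator_norm_witness[OF \<epsilon>2, of S] by blast
  have cK: "compact (insert z0 K)" and cL: "compact (insert y0 L)" using K L by (auto intro: compact_insert)
  from nest_local_reflexivity_compact_complex[where Q = Q and S = S, OF Q' fin inv' cK cL \<epsilon>2]
  obtain T :: "'a \<Rightarrow>\<^sub>C\<^sub>L 'a" where T: "finite_rank scaleC (cblinfun_apply T)"
    "\<forall>U\<in>scheme_nest Q. cblinfun_apply T ` U \<subseteq> U" "norm T < norm S + \<epsilon> / 2"
    "\<forall>z\<in>insert z0 K. \<forall>y\<in>insert y0 L.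
      norm (cblinfun_apply z (cadjoint_op T y) - cblinfun_apply (cblinfun_apply S z) y) < \<epsilon> / 2"
    by blast
  let ?u = "cblinfun_apply z0 (cadjoint_op T y0)" and ?v = "cblinfun_apply (cblinfun_apply S z0) y0"
  have "norm ?u \<le> norm T"
    using cadjoint_pairing_le[of z0 T y0] mult_le_of_le_1[of "norm T" "norm z0" "norm y0"] zy by simp
  moreover have "norm (?u - ?v) < \<epsilon> / 2" using T(4) by simp
  moreover have "norm ?v \<le> norm ?u + norm (?u - ?v)"
    using norm_triangle_sub[of ?v ?u] by (simp add: norm_minus_commute)
  ultimately have "\<bar>norm T - norm S\<bar> < \<epsilon>" using zy(3) T(3) by linarith
  moreover have "norm (cblinfun_apply z (cadjoint_op T y) - cblinfun_apply (cblinfun_apply S z) y) < \<epsilon>"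
    if "z \<in> K" "y \<in> L" for z y
  proof -
    have "norm (cblinfun_apply z (cadjoint_op T y) - cblinfun_apply (cblinfun_apply S z) y) < \<epsilon> / 2"
      using T(4) that by simp
    then show ?thesis using \<epsilon> by linarith
  qed
  ultimately show ?thesis using T(1,2) by blast
qed

theorem theorem4p3:
  fixes Q :: "nat \<Rightarrow> 'a::banach set" and R :: "nat \<Rightarrow> 'b::complex_banach set"
  shows
    "(ga_scheme scaleR Q \<and> admissible Q \<longrightarrow>
      (\<forall>(S :: 'a bidual \<Rightarrow>\<^sub>L 'a bidual) (K :: 'a bidual set) (L :: 'a dual set) (\<epsilon> :: real).
        finite_rank scaleR (blinfun_apply S) \<and>
        (\<forall>U\<in>scheme_nest Q. blinfun_apply S ` biannihilator U \<subseteq> biannihilator U) \<and>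
        compact K \<and> compact L \<and> \<epsilon> > 0 \<longrightarrow>
        (\<exists>T :: 'a \<Rightarrow>\<^sub>L 'a.
          finite_rank scaleR (blinfun_apply T) \<and>
          (\<forall>U\<in>scheme_nest Q. blinfun_apply T ` U \<subseteq> U) \<and>
          \<bar>norm T - norm S\<bar> < \<epsilon> \<and>
          (\<forall>x\<in>K. \<forall>y\<in>L. \<bar>blinfun_apply x (adjoint_op T y) - blinfun_apply (blinfun_apply S x) y\<bar> < \<epsilon>)))) \<and>
     (ga_scheme scaleC R \<and> cadmissible R \<longrightarrow>
      (\<forall>(S :: 'b cbidual \<Rightarrow>\<^sub>C\<^sub>L 'b cbidual) (K :: 'b cbidual set) (L :: 'b cdual set) (\<epsilon> :: real).
        finite_rank scaleC (cblinfun_apply S) \<and>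
        (\<forall>U\<in>scheme_nest R. cblinfun_apply S ` cbiannihilator U \<subseteq> cbiannihilator U) \<and>
        compact K \<and> compact L \<and> \<epsilon> > 0 \<longrightarrow>
        (\<exists>T :: 'b \<Rightarrow>\<^sub>C\<^sub>L 'b.
          finite_rank scaleC (cblinfun_apply T) \<and>
          (\<forall>U\<in>scheme_nest R. cblinfun_apply T ` U \<subseteq> U) \<and>
          \<bar>norm T - norm S\<bar> < \<epsilon> \<and>
          (\<forall>x\<in>K. \<forall>y\<in>L. norm (cblinfun_apply x (cadjoint_op T y) - cblinfun_apply (cblinfun_apply S x) y) < \<epsilon>))))"
  by (intro conjI impI allI; elim conjE)
    (rule nest_local_reflexivity nest_local_reflexivity_complex; assumption)+

end
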